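(* Let $(\mathfrak{g},[~,~],\alpha)$ be a (multiplicative) Hom-Lie algebra over $\mathbf{k}$ and let $\lambda\in\mathbf{k}$. The differential map $d_\lambda$ is a graded derivation for the derived bracket $[~,~]_{\mathsf{D}}$. That is, $(C^\bullet_{\mathrm{Hom}}(\mathfrak{g},\mathfrak{g}),[~,~]_{\mathsf{D}},d_\lambda)$ is a differential graded Lie algebra.
   Context: All vector spaces and (multi)linear maps are over a field $\mathbf{k}$ of characteristic $0$. A (multiplicative) Hom-Lie algebra $(\mathfrak{g},[~,~],\alpha)$ is a vector space $\mathfrak{g}$ with a skew-symmetric bilinear map $[~,~]$ and a linear map $\alpha:\mathfrak{g}\to\mathfrak{g}$ such that $[\alpha(x),[y,z]]+[\alpha(y),[z,x]]+[\alpha(z),[x,y]]=0$ and $\alpha([x,y])=[\alpha(x),\alpha(y)]$. For $n\ge1$, $C^n_{\mathrm{Hom}}(\mathfrak{g},\mathfrak{g})=\{f:\wedge^n\mathfrak{g}\to\mathfrak{g}\mid\alpha\circ f=f\circ\alpha^{\wedge n}\}$, in degree $n$; $C^\bullet_{\mathrm{Hom}}(\mathfrak{g},\mathfrak{g})=\bigoplus_{n\ge1}C^n_{\mathrm{Hom}}(\mathfrak{g},\mathfrak{g})$. $Sh(m,n)$ is the set of $(m,n)$-shuffles. For $P\in C^m_{\mathrm{Hom}}(\mathfrak{g},\mathfrak{g})$, $Q\in C^n_{\mathrm{Hom}}(\mathfrak{g},\mathfrak{g})$: $$(i_PQ)(x_1,\ldots,x_{m+n-1})=\sum_{\sigma\in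 Sh(m,n-1)}(-1)^\sigma Q\big(P(x_{\sigma(1)},\ldots,x_{\sigma(m)}),\alpha^{m-1}x_{\sigma(m+1)},\ldots,\alpha^{m-1}x_{\sigma(m+n-1)}\big),$$ $$[P,Q]_{\mathsf{C}}(x_1,\ldots,x_{m+n})=\sum_{\sigma\in Sh(m,n)}(-1)^\sigma[\alpha^{n-1}P(x_{\sigma(1)},\ldots,x_{\sigma(m)}),\alpha^{m-1}Q(x_{\sigma(m+1)},\ldots,x_{\sigma(m+n)})].$$ Let $\mu\in C^2_{\mathrm{Hom}}(\mathfrak{g},\mathfrak{g})$, $\mu(x,y)=[x,y]$, and $\theta f=-i_f\mu$. The derived bracket, a graded Lie bracket on $C^\bullet_{\mathrm{Hom}}(\mathfrak{g},\mathfrak{g})$, is $[P,Q]_{\mathsf{D}}=[P,Q]_{\mathsf{C}}+i_{\theta P}Q-(-1)^{mn}i_{\theta Q}P$. The map $d_\lambda:C^n_{\mathrm{Hom}}(\mathfrak{g},\mathfrak{g})\to C^{n+1}_{\mathrm{Hom}}(\mathfrak{g},\mathfrak{g})$ is $d_\lambda(f)=-\lambda\,i_\mu f$, explicitly $$(d_\lambda f)(x_1,\ldots,x_{n+1})=\lambda\sum_{1\le i<j\le n+1}(-1)^{i+j}f([x_i,x_j],\alpha(x_1),\ldots,\widehat{\alpha(x_i)},\ldots,\widehat{\alpha(x_j)},\ldots,\alpha(x_{n+1})).$$ It satisfies $(d_\lambda)^2=0$. Graded derivation means $d_\lambda[P,Q]_{\mathsf{D}}=[d_\lambda P,Q]_{\mathsf{D}}+(-1)^m[P,d_\lambda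 Q]_{\mathsf{D}}$ for $P\in C^m_{\mathrm{Hom}}(\mathfrak{g},\mathfrak{g})$. *)

theory Defs
  imports Complex_Main "HOL-Combinatorics.Permutations" "HOL-Library.Function_Algebras"
begin

section \<open>Differential graded Lie algebras graded by the positive integers\<close>

text \<open>
  A graded vector space is given by its homogeneous components \<open>V n\<close> (\<open>n \<ge> 1\<close>), which are
  subspaces of one ambient space; the graded object is their (external) direct sum.
  The operations are given on homogeneous elements, hence carry the degrees of their arguments:
  \<open>br m n\<close> maps \<open>V m \<times> V n\<close> to \<open>V (m + n)\<close> and \<open>d n\<close> maps \<open>V n\<close> to \<open>V (n + 1)\<close>.
  Outside these components, and in degree 0, nothing is required of them.
\<close>

definition graded_derivation ::
  "('k::field \<Rightarrow> 'a::ab_group_add \<Rightarrow> 'a) \<Rightarrow> (nat \<Rightarrow> 'a set) \<Rightarrow>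
   (nat \<Rightarrow> nat \<Rightarrow> 'a \<Rightarrow> 'a \<Rightarrow> 'a) \<Rightarrow> (nat \<Rightarrow> 'a \<Rightarrow> 'a) \<Rightarrow> bool"
  where "graded_derivation scale V br d \<longleftrightarrow>
    (\<forall>m\<ge>1. \<forall>n\<ge>1. \<forall>P\<in>V m. \<forall>Q\<in>V n.
       d (m + n) (br m n P Q) =
         br (m + 1) n (d m P) Q + scale ((-1) ^ m) (br m (n + 1) P (d n Q)))"

locale graded_lie_algebra = vector_space scale
  for scale :: "'k::field_char_0 \<Rightarrow> 'a::ab_group_add \<Rightarrow> 'a" (infixr \<open>*s\<close> 75) +
  fixes V :: "nat \<Rightarrow> 'a set"
    and br :: "nat \<Rightarrow> nat \<Rightarrow> 'a \<Rightarrow> 'a \<Rightarrow> 'a"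
  assumes subspace_V: "n \<ge> 1 \<Longrightarrow> subspace (V n)"
    and br_closed: "\<lbrakk>m \<ge> 1; n \<ge> 1; P \<in> V m; Q \<in> V n\<rbrakk> \<Longrightarrow> br m n P Q \<in> V (m + n)"
    and br_add_left: "\<lbrakk>m \<ge> 1; n \<ge> 1; P \<in> V m; P' \<in> V m; Q \<in> V n\<rbrakk>
          \<Longrightarrow> br m n (P + P') Q = br m n P Q + br m n P' Q"
    and br_scale_left: "\<lbrakk>m \<ge> 1; n \<ge> 1; P \<in> V m; Q \<in> V n\<rbrakk>
          \<Longrightarrow> br m n (c *s P) Q = c *s br m n P Q"
    and br_add_right: "\<lbrakk>m \<ge> 1; n \<ge> 1; P \<in> V m; Q \<in> V n; Q' \<in> V n\<rbrakk>
          \<Longrightarrow> br m n P (Q + Q') = br m n P Q + br m n P Q'"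
    and br_scale_right: "\<lbrakk>m \<ge> 1; n \<ge> 1; P \<in> V m; Q \<in> V n\<rbrakk>
          \<Longrightarrow> br m n P (c *s Q) = c *s br m n P Q"
    and br_skew: "\<lbrakk>m \<ge> 1; n \<ge> 1; P \<in> V m; Q \<in> V n\<rbrakk>
          \<Longrightarrow> br m n P Q = - ((-1) ^ (m * n) *s br n m Q P)"
    and br_jacobi: "\<lbrakk>m \<ge> 1; n \<ge> 1; k \<ge> 1; P \<in> V m; Q \<in> V n; R \<in> V k\<rbrakk>
          \<Longrightarrow> br m (n + k) P (br n k Q R) =
              br (m + n) k (br m n P Q) R + (-1) ^ (m * n) *s br n (m + k) Q (br m k P R)"

locale dg_lie_algebra = graded_lie_algebra scale V br
  for scale :: "'k::field_char_0 \<Rightarrow> 'a::ab_group_add \<Rightarrow> 'a" (infixr \<open>*s\<close> 75) and V br +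
  fixes d :: "nat \<Rightarrow> 'a \<Rightarrow> 'a"
  assumes d_closed: "\<lbrakk>n \<ge> 1; P \<in> V n\<rbrakk> \<Longrightarrow> d n P \<in> V (n + 1)"
    and d_add: "\<lbrakk>n \<ge> 1; P \<in> V n; P' \<in> V n\<rbrakk> \<Longrightarrow> d n (P + P') = d n P + d n P'"
    and d_scale: "\<lbrakk>n \<ge> 1; P \<in> V n\<rbrakk> \<Longrightarrow> d n (c *s P) = c *s d n P"
    and d_square: "\<lbrakk>n \<ge> 1; P \<in> V n\<rbrakk> \<Longrightarrow> d (n + 1) (d n P) = 0"
    and d_derivation: "graded_derivation scale V br d"


section \<open>Hom-Lie algebras and their cochains\<close>

definition shuffles_perm :: "nat \<Rightarrow> nat \<Rightarrow> (nat \<Rightarrow> nat) set"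
  where "shuffles_perm m n = {\<sigma>. \<sigma> permutes {..<m + n} \<and>
    strict_mono_on {..<m} \<sigma> \<and> strict_mono_on {m..<m + n} \<sigma>}"

locale hom_lie_algebra = vector_space scale
  for scale :: "'k::field_char_0 \<Rightarrow> 'v::ab_group_add \<Rightarrow> 'v" (infixr \<open>*s\<close> 75) +
  fixes bracket :: "'v \<Rightarrow> 'v \<Rightarrow> 'v" (\<open>[_,/ _]\<^sub>\<g>\<close>)
    and \<alpha> :: "'v \<Rightarrow> 'v"
  assumes linear_alpha: "Vector_Spaces.linear scale scale \<alpha>"
    and linear_bracket_left: "Vector_Spaces.linear scale scale (\<lambda>x. [x, y]\<^sub>\<g>)"
    and linear_bracket_right: "Vector_Spaces.linear scale scale (\<lambda>y. [x, y]\<^sub>\<g>)"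
    and bracket_skew: "[x, y]\<^sub>\<g> = - [y, x]\<^sub>\<g>"
    and hom_jacobi: "[\<alpha> x, [y, z]\<^sub>\<g>]\<^sub>\<g> + [\<alpha> y, [z, x]\<^sub>\<g>]\<^sub>\<g> + [\<alpha> z, [x, y]\<^sub>\<g>]\<^sub>\<g> = 0"
    and multiplicative: "\<alpha> [x, y]\<^sub>\<g> = [\<alpha> x, \<alpha> y]\<^sub>\<g>"
begin

text \<open>
  An \<open>n\<close>-linear map is a function of a sequence \<open>x\<close> that reads only the entries
  \<open>x 0, \<dots>, x (n - 1)\<close> (so \<open>x\<^sub>i\<close> in the usual notation is \<open>x (i - 1)\<close>); a linear map on the
  \<open>n\<close>-th exterior power is an alternating \<open>n\<close>-linear map.
\<close>

definition cochains :: "nat \<Rightarrow> ((nat \<Rightarrow> 'v) \<Rightarrow> 'v) set"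
  where "cochains n = {f.
     (\<forall>x y. (\<forall>i<n. x i = y i) \<longrightarrow> f x = f y) \<and>
     (\<forall>x. \<forall>i<n. Vector_Spaces.linear scale scale (\<lambda>v. f (x(i := v)))) \<and>
     (\<forall>x. (\<exists>i<n. \<exists>j<n. i \<noteq> j \<and> x i = x j) \<longrightarrow> f x = 0) \<and>
     (\<forall>x. \<alpha> (f x) = f (\<lambda>i. \<alpha> (x i)))}"

definition cochain_scale :: "'k \<Rightarrow> ((nat \<Rightarrow> 'v) \<Rightarrow> 'v) \<Rightarrow> (nat \<Rightarrow> 'v) \<Rightarrow> 'v"
  where "cochain_scale c f = (\<lambda>x. c *s f x)"

text \<open>
  In the operations below, \<open>m\<close> and \<open>n\<close> are the degrees of \<open>P\<close> and \<open>Q\<close>; they are only meant for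
  \<open>m, n \<ge> 1\<close>, so the natural-number differences are genuine. The argument
  \<open>case_nat v y\<close> is the sequence \<open>v, y 0, y 1, \<dots>\<close>.
\<close>

definition insertion ::
  "nat \<Rightarrow> nat \<Rightarrow> ((nat \<Rightarrow> 'v) \<Rightarrow> 'v) \<Rightarrow> ((nat \<Rightarrow> 'v) \<Rightarrow> 'v) \<Rightarrow> (nat \<Rightarrow> 'v) \<Rightarrow> 'v"
  where "insertion m n P Q = (\<lambda>x. \<Sum>\<sigma>\<in>shuffles_perm m (n - 1).
     of_int (sign \<sigma>) *s
       Q (case_nat (P (\<lambda>i. x (\<sigma> i))) (\<lambda>i. (\<alpha> ^^ (m - 1)) (x (\<sigma> (m + i))))))"

definition cup_bracket ::
  "nat \<Rightarrow> nat \<Rightarrow> ((nat \<Rightarrow> 'v) \<Rightarrow> 'v) \<Rightarrow> ((nat \<Rightarrow> 'v) \<Rightarrow> 'v) \<Rightarrow> (nat \<Rightarrow> 'v) \<Rightarrow> 'v"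
  where "cup_bracket m n P Q = (\<lambda>x. \<Sum>\<sigma>\<in>shuffles_perm m n.
     of_int (sign \<sigma>) *s
       [(\<alpha> ^^ (n - 1)) (P (\<lambda>i. x (\<sigma> i))), (\<alpha> ^^ (m - 1)) (Q (\<lambda>i. x (\<sigma> (m + i))))]\<^sub>\<g>)"

definition \<mu> :: "(nat \<Rightarrow> 'v) \<Rightarrow> 'v"
  where "\<mu> = (\<lambda>x. [x 0, x 1]\<^sub>\<g>)"

definition \<theta> :: "nat \<Rightarrow> ((nat \<Rightarrow> 'v) \<Rightarrow> 'v) \<Rightarrow> (nat \<Rightarrow> 'v) \<Rightarrow> 'v"
  where "\<theta> n f = - insertion n 2 f \<mu>"

definition derived_bracket ::
  "nat \<Rightarrow> nat \<Rightarrow> ((nat \<Rightarrow> 'v) \<Rightarrow> 'v) \<Rightarrow> ((nat \<Rightarrow> 'v) \<Rightarrow> 'v) \<Rightarrow> (nat \<Rightarrow> 'v) \<Rightarrow> 'v"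
  where "derived_bracket m n P Q =
     cup_bracket m n P Q + insertion (m + 1) n (\<theta> m P) Q
       - cochain_scale ((-1) ^ (m * n)) (insertion (n + 1) m (\<theta> n Q) P)"

definition d_lam :: "'k \<Rightarrow> nat \<Rightarrow> ((nat \<Rightarrow> 'v) \<Rightarrow> 'v) \<Rightarrow> (nat \<Rightarrow> 'v) \<Rightarrow> 'v"
  where "d_lam lam n f = cochain_scale (- lam) (insertion 2 n \<mu> f)"

end

end

theory Submission
  imports Defs
begin

text \<open>
  Two operations carry the whole structure: the cup bracket \<open>c(P, Q) = [P, Q]\<^sub>C\<close> and the insertion
  \<open>i\<^sub>P Q\<close>. Three facts about them are needed: the cup bracket is a graded Lie bracket; \<open>i\<^sub>P\<close>, for
  \<open>P\<close> of degree \<open>m + 1\<close>, is a derivation of degree \<open>m\<close> of the cup bracket; and insertion is a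
  graded pre-Lie product, so that \<open>[i\<^sub>P, i\<^sub>Q]\<close> is insertion of the Nijenhuis-Richardson bracket
  \<open>{P, Q} = i\<^sub>P Q - (-1)\<^sup>m\<^sup>n i\<^sub>Q P\<close> (degrees \<open>m + 1\<close> and \<open>n + 1\<close>). The identity map \<open>e\<close>, a cochain
  of degree 1, ties \<open>\<mu>\<close> to the cup bracket: \<open>c(e, e) = 2\<mu>\<close>, and the derivation property together
  with \<open>i\<^sub>P e = P\<close> gives \<open>i\<^sub>P \<mu> = c(P, e)\<close>, hence \<open>\<theta> P = - c(P, e)\<close>.

  From here on the argument is formal. The Jacobi identity of \<open>c\<close> with third argument \<open>e\<close> says
  \<open>\<theta> [P, Q]\<^sub>D = {\<theta> P, \<theta> Q}\<close> (lemma \<open>theta_derived\<close>): the pairs \<open>(\<theta> P, P)\<close> are closed under the bracket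
  of the semidirect product of the Nijenhuis-Richardson algebra with the cup algebra, and the
  derived bracket is the bracket induced on these pairs; this is why it satisfies the Jacobi
  identity (\<open>derived_jacobi\<close>). The same calculus gives \<open>\<theta> (i\<^sub>\<mu> P) = {\<mu>, \<theta> P}\<close> (\<open>theta_ins_mu\<close>),
  which turns the derivation property of \<open>i\<^sub>\<mu>\<close> for the cup bracket into the one for the derived
  bracket (\<open>ins_mu_derivation\<close>). Finally \<open>i\<^sub>\<mu> \<mu> = c(\<mu>, e)\<close> is half of \<open>c(c(e, e), e)\<close>, which the
  Jacobi identity forces to vanish; so \<open>2 (i\<^sub>\<mu>)\<^sup>2\<close> is insertion of \<open>{\<mu>, \<mu>} = 2 i\<^sub>\<mu> \<mu> = 0\<close>.

  The three facts about shuffle sums are proved without permutations. A cochain is viewed as a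
  function of lists, and a signed sum over shuffles becomes a recursively defined sum over all ways
  to split a list into two subsequences, the coproduct of the exterior algebra. Coassociativity and
  graded cocommutativity of this coproduct are list inductions (\<open>unshuffle_coassoc\<close>,
  \<open>unshuffle_cocomm\<close>); they reduce each identity to a comparison of summands, where only the powers
  of \<open>\<alpha>\<close> and the signs have to be matched. Permutations enter once, in
  \<open>unshuffle_eq_sum_shuffles\<close>.
\<close>

section \<open>Differential graded Lie algebras from insertions\<close>

text \<open>
  \<open>ins m n P Q\<close> abstracts \<open>i\<^sub>P Q\<close>. The degree of the inserted element is written \<open>Suc m\<close> because
  insertion of an element of degree \<open>m + 1\<close> raises degrees by \<open>m\<close>, and \<open>m\<close> is the degree that enters
  the signs. The pre-Lie axiom is the graded symmetry of the associator.
\<close>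

locale insertion_lie_algebra = graded_lie_algebra scale V c
  for scale :: "'k::field_char_0 \<Rightarrow> 'a::ab_group_add \<Rightarrow> 'a" (infixr \<open>*s\<close> 75) and V c +
  fixes ins :: "nat \<Rightarrow> nat \<Rightarrow> 'a \<Rightarrow> 'a \<Rightarrow> 'a"
    and e mu :: 'a
  assumes ins_closed: "\<lbrakk>n \<ge> 1; P \<in> V (Suc m); Q \<in> V n\<rbrakk> \<Longrightarrow> ins (Suc m) n P Q \<in> V (m + n)"
    and ins_add_left: "\<lbrakk>n \<ge> 1; P \<in> V (Suc m); P' \<in> V (Suc m); Q \<in> V n\<rbrakk>
          \<Longrightarrow> ins (Suc m) n (P + P') Q = ins (Suc m) n P Q + ins (Suc m) n P' Q"
    and ins_scale_left: "\<lbrakk>n \<ge> 1; P \<in> V (Suc m); Q \<in> V n\<rbrakk>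
          \<Longrightarrow> ins (Suc m) n (a *s P) Q = a *s ins (Suc m) n P Q"
    and ins_add_right: "\<lbrakk>n \<ge> 1; P \<in> V (Suc m); Q \<in> V n; Q' \<in> V n\<rbrakk>
          \<Longrightarrow> ins (Suc m) n P (Q + Q') = ins (Suc m) n P Q + ins (Suc m) n P Q'"
    and ins_scale_right: "\<lbrakk>n \<ge> 1; P \<in> V (Suc m); Q \<in> V n\<rbrakk>
          \<Longrightarrow> ins (Suc m) n P (a *s Q) = a *s ins (Suc m) n P Q"
    and ins_pre_lie: "\<lbrakk>k \<ge> 1; P \<in> V (Suc m); Q \<in> V (Suc n); R \<in> V k\<rbrakk> \<Longrightarrow>
          ins (Suc m) (n + k) P (ins (Suc n) k Q R) -
            ins (Suc (m + n)) k (ins (Suc m) (Suc n) P Q) R =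
          (-1) ^ (m * n) *s (ins (Suc n) (m + k) Q (ins (Suc m) k P R) -
            ins (Suc (n + m)) k (ins (Suc n) (Suc m) Q P) R)"
    and ins_derivation: "\<lbrakk>n \<ge> 1; k \<ge> 1; P \<in> V (Suc m); Q \<in> V n; R \<in> V k\<rbrakk> \<Longrightarrow>
          ins (Suc m) (n + k) P (c n k Q R) =
          c (m + n) k (ins (Suc m) n P Q) R + (-1) ^ (m * n) *s c n (m + k) Q (ins (Suc m) k P R)"
    and e_closed: "e \<in> V 1"
    and ins_e: "P \<in> V (Suc m) \<Longrightarrow> ins (Suc m) 1 P e = P"
    and mu_closed: "mu \<in> V 2"
    and c_e_e: "c 1 1 e e = 2 *s mu"
begin

lemma c_e_e' [simp]: "c (Suc 0) (Suc 0) e e = 2 *s mu"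
  using c_e_e by simp

lemma mu_closed' [simp]: "mu \<in> V (Suc 1)" "mu \<in> V (Suc (Suc 0))"
  using mu_closed by (simp_all add: numeral_2_eq_2)

lemma V_add: "n \<ge> 1 \<Longrightarrow> P \<in> V n \<Longrightarrow> Q \<in> V n \<Longrightarrow> P + Q \<in> V n"
  using subspace_V subspace_add by blast

lemma V_scale: "n \<ge> 1 \<Longrightarrow> P \<in> V n \<Longrightarrow> a *s P \<in> V n"
  using subspace_V subspace_scale by blast

lemma V_neg: "n \<ge> 1 \<Longrightarrow> P \<in> V n \<Longrightarrow> - P \<in> V n"
  using subspace_V subspace_neg by blast

lemma V_diff: "n \<ge> 1 \<Longrightarrow> P \<in> V n \<Longrightarrow> Q \<in> V n \<Longrightarrow> P - Q \<in> V n"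
  using subspace_V subspace_diff by blast

lemma c_neg_left: "m \<ge> 1 \<Longrightarrow> n \<ge> 1 \<Longrightarrow> P \<in> V m \<Longrightarrow> Q \<in> V n \<Longrightarrow> c m n (- P) Q = - c m n P Q"
  using br_scale_left[of m n P Q "-1"] by simp

lemma c_neg_right: "m \<ge> 1 \<Longrightarrow> n \<ge> 1 \<Longrightarrow> P \<in> V m \<Longrightarrow> Q \<in> V n \<Longrightarrow> c m n P (- Q) = - c m n P Q"
  using br_scale_right[of m n P Q "-1"] by simp

lemma ins_neg_left:
  "n \<ge> 1 \<Longrightarrow> P \<in> V (Suc m) \<Longrightarrow> Q \<in> V n \<Longrightarrow> ins (Suc m) n (- P) Q = - ins (Suc m) n P Q"
  using ins_scale_left[of n P m Q "-1"] by simp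

lemma ins_neg_right:
  "n \<ge> 1 \<Longrightarrow> P \<in> V (Suc m) \<Longrightarrow> Q \<in> V n \<Longrightarrow> ins (Suc m) n P (- Q) = - ins (Suc m) n P Q"
  using ins_scale_right[of n P m Q "-1"] by simp

lemma c_diff_left: "m \<ge> 1 \<Longrightarrow> n \<ge> 1 \<Longrightarrow> P \<in> V m \<Longrightarrow> P' \<in> V m \<Longrightarrow> Q \<in> V n \<Longrightarrow>
    c m n (P - P') Q = c m n P Q - c m n P' Q"
  using br_add_left[of m n P "- P'" Q] by (simp add: V_neg c_neg_left)

lemma c_diff_right: "m \<ge> 1 \<Longrightarrow> n \<ge> 1 \<Longrightarrow> P \<in> V m \<Longrightarrow> Q \<in> V n \<Longrightarrow> Q' \<in> V n \<Longrightarrow>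
    c m n P (Q - Q') = c m n P Q - c m n P Q'"
  using br_add_right[of m n P Q "- Q'"] by (simp add: V_neg c_neg_right)

lemma ins_diff_left: "n \<ge> 1 \<Longrightarrow> P \<in> V (Suc m) \<Longrightarrow> P' \<in> V (Suc m) \<Longrightarrow> Q \<in> V n \<Longrightarrow>
    ins (Suc m) n (P - P') Q = ins (Suc m) n P Q - ins (Suc m) n P' Q"
  using ins_add_left[of n P m "- P'" Q] by (simp add: V_neg ins_neg_left)

lemma ins_diff_right: "n \<ge> 1 \<Longrightarrow> P \<in> V (Suc m) \<Longrightarrow> Q \<in> V n \<Longrightarrow> Q' \<in> V n \<Longrightarrow>
    ins (Suc m) n P (Q - Q') = ins (Suc m) n P Q - ins (Suc m) n P Q'"
  using ins_add_right[of n P m Q "- Q'"] by (simp add: V_neg ins_neg_right)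

lemmas c_lin = br_add_left br_scale_left br_add_right br_scale_right
  c_neg_left c_neg_right c_diff_left c_diff_right
lemmas ins_lin = ins_add_left ins_scale_left ins_add_right ins_scale_right
  ins_neg_left ins_neg_right ins_diff_left ins_diff_right
lemmas V_closed = V_add V_scale V_neg V_diff

text \<open>
  For a Hom-Lie algebra these two become the maps \<open>\<theta>\<close> and \<open>[_, _]\<^sub>D\<close>.
\<close>

definition theta :: "nat \<Rightarrow> 'a \<Rightarrow> 'a"
  where "theta n P = - ins n 2 P mu"

definition derived :: "nat \<Rightarrow> nat \<Rightarrow> 'a \<Rightarrow> 'a \<Rightarrow> 'a"
  where "derived m n P Q = c m n P Q + ins (m + 1) n (theta m P) Q
    - (-1) ^ (m * n) *s ins (n + 1) m (theta n Q) P"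

lemma scale_two_cancel: "(2::'k) *s x = 2 *s y \<Longrightarrow> x = y"
  by simp

lemma scale_two: "(2::'k) *s x = x + x"
  using scale_left_distrib[of 1 1 x] by simp

text \<open>
  Expand \<open>i\<^sub>P c(e, e)\<close> by the derivation property: \<open>i\<^sub>P e = P\<close> produces \<open>c(P, e)\<close> and \<open>\<plusminus> c(e, P)\<close>, and
  the two agree by skew symmetry.
\<close>

lemma ins_mu:
  assumes P: "P \<in> V (Suc m)"
  shows "ins (Suc m) 2 P mu = c (Suc m) 1 P e"
proof (rule scale_two_cancel)
  have "2 *s ins (Suc m) 2 P mu = ins (Suc m) (1 + 1) P (c 1 1 e e)"
    using ins_scale_right[OF _ P mu_closed] by (simp add: c_e_e numeral_2_eq_2)
  also have "\<dots> = c (Suc m) 1 P e + (-1) ^ m *s c 1 (Suc m) e P"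
    using ins_derivation[of 1 1 P m e e] P e_closed by (simp add: ins_e[OF P, simplified])
  also have "\<dots> = 2 *s c (Suc m) 1 P e"
    using br_skew[of 1 "Suc m" e P] P e_closed
    by (cases "even m") (simp_all add: scale_two)
  finally show "2 *s ins (Suc m) 2 P mu = 2 *s c (Suc m) 1 P e" .
qed

lemma theta_eq: "m \<ge> 1 \<Longrightarrow> P \<in> V m \<Longrightarrow> theta m P = - c m 1 P e"
  using ins_mu[of P "m - 1"] by (cases m) (simp_all add: theta_def)

lemma theta_closed: "m \<ge> 1 \<Longrightarrow> P \<in> V m \<Longrightarrow> theta m P \<in> V (Suc m)"
  using br_closed[of m 1 P e] e_closed by (simp add: theta_eq V_neg)

lemma theta_add: "m \<ge> 1 \<Longrightarrow> P \<in> V m \<Longrightarrow> P' \<in> V m \<Longrightarrow> theta m (P + P') = theta m P + theta m P'"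
  using e_closed by (simp add: theta_eq V_add br_add_left)

lemma theta_scale: "m \<ge> 1 \<Longrightarrow> P \<in> V m \<Longrightarrow> theta m (a *s P) = a *s theta m P"
  using e_closed by (simp add: theta_eq V_scale br_scale_left)

lemma theta_neg: "m \<ge> 1 \<Longrightarrow> P \<in> V m \<Longrightarrow> theta m (- P) = - theta m P"
  using theta_scale[of m P "-1"] by simp

lemma theta_diff: "m \<ge> 1 \<Longrightarrow> P \<in> V m \<Longrightarrow> P' \<in> V m \<Longrightarrow> theta m (P - P') = theta m P - theta m P'"
  using theta_add[of m P "- P'"] by (simp add: V_neg theta_neg)

lemma ins_theta_theta:
  assumes "m \<ge> 1" "n \<ge> 1" "P \<in> V m" "Q \<in> V n"
  shows "ins (Suc m) (Suc n) (theta m P) (theta n Q) =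
    theta (m + n) (ins (Suc m) n (theta m P) Q) - (-1) ^ (m * n) *s c n (m + 1) Q (theta m P)"
proof -
  have TP: "theta m P \<in> V (Suc m)" and TQ: "ins (Suc m) n (theta m P) Q \<in> V (m + n)"
    using assms by (simp_all add: theta_closed ins_closed)
  have "ins (Suc m) (Suc n) (theta m P) (theta n Q) = - ins (Suc m) (n + 1) (theta m P) (c n 1 Q e)"
    using assms TP e_closed br_closed[of n 1 Q e] ins_neg_right[of "Suc n" "theta m P" m "c n 1 Q e"]
    by (simp add: theta_eq)
  also have "\<dots> = theta (m + n) (ins (Suc m) n (theta m P) Q) - (-1) ^ (m * n) *s c n (m + 1) Q (theta m P)"
    using ins_derivation[of n 1 "theta m P" m Q e] assms TP TQ e_closed ins_e[OF TP]
    by (simp add: theta_eq[of "m + n"])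
  finally show ?thesis .
qed

text \<open>
  The Jacobi identity for \<open>P\<close>, \<open>Q\<close> and \<open>e\<close>.
\<close>

lemma theta_c:
  assumes "m \<ge> 1" "n \<ge> 1" "P \<in> V m" "Q \<in> V n"
  shows "theta (m + n) (c m n P Q) = c m (n + 1) P (theta n Q) - (-1) ^ (m * n) *s c n (m + 1) Q (theta m P)"
  using br_jacobi[of m n 1 P Q e] assms e_closed br_closed[of n 1 Q e] br_closed[of m 1 P e]
  by (simp add: theta_eq br_closed c_neg_right algebra_simps)

lemma derived_closed:
  assumes "m \<ge> 1" "n \<ge> 1" "P \<in> V m" "Q \<in> V n"
  shows "derived m n P Q \<in> V (m + n)"
proof -
  have "ins (Suc n) m (theta n Q) P \<in> V (m + n)"
    using ins_closed[of m "theta n Q" n P] theta_closed assms by (simp add: add.commute)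
  thus ?thesis
  using assms ins_closed[of n "theta m P" m Q] theta_closed
  by (simp add: derived_def V_closed br_closed)
qed

text \<open>
  In terms of \<open>theta\<close> this is the statement that \<open>theta\<close> is a relative Rota-Baxter operator of
  weight 1: its graph is a subalgebra of the semidirect product. The defects in \<open>theta_c\<close> and
  \<open>ins_theta_theta\<close> cancel.
\<close>

lemma theta_derived:
  assumes "m \<ge> 1" "n \<ge> 1" "P \<in> V m" "Q \<in> V n"
  shows "theta (m + n) (derived m n P Q) = ins (Suc m) (Suc n) (theta m P) (theta n Q)
     - (-1) ^ (m * n) *s ins (Suc n) (Suc m) (theta n Q) (theta m P)"
proof -
  have 1: "ins (Suc n) m (theta n Q) P \<in> V (m + n)" "ins (Suc m) n (theta m P) Q \<in> V (m + n)"
     "c m n P Q \<in> V (m + n)"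
    using ins_closed[of m "theta n Q" n P] ins_closed[of n "theta m P" m Q] br_closed theta_closed assms
    by (simp_all add: add.commute)
  have "theta (m + n) (derived m n P Q) = theta (m + n) (c m n P Q) + theta (m + n) (ins (Suc m) n (theta m P) Q) -
    (-1) ^ (m * n) *s theta (m + n) (ins (Suc n) m (theta n Q) P)"
    using assms 1 by (simp add: derived_def theta_add theta_diff theta_scale V_closed)
  thus ?thesis
    using assms ins_theta_theta[of m n P Q] ins_theta_theta[of n m Q P] theta_c[of m n P Q]
    by (cases "even (m * n)") (simp_all add: add.commute mult.commute)
qed

text \<open>
  The pre-Lie identity, read as: insertion represents the Nijenhuis-Richardson bracket.
\<close>

lemma ins_commutator:
  assumes "k \<ge> 1" "X \<in> V (Suc m)" "Y \<in> V (Suc n)" "R \<in> V k"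
  shows "ins (Suc (m + n)) k (ins (Suc m) (Suc n) X Y - (-1) ^ (m * n) *s ins (Suc n) (Suc m) Y X) R =
    ins (Suc m) (n + k) X (ins (Suc n) k Y R) - (-1) ^ (m * n) *s ins (Suc n) (m + k) Y (ins (Suc m) k X R)"
proof -
  have 1: "ins (Suc m) (Suc n) X Y \<in> V (Suc (m + n))" "ins (Suc n) (Suc m) Y X \<in> V (Suc (m + n))"
    using ins_closed[of "Suc n" X m Y] ins_closed[of "Suc m" Y n X] assms
    by (simp_all add: add.commute)
  show ?thesis
    using ins_pre_lie[OF assms] assms 1
    by (simp add: ins_diff_left ins_scale_left V_scale add.commute[of n m] scale_right_diff_distrib)
       (simp add: algebra_simps)
qed

lemma ins_theta_derived:
  assumes "k \<ge> 1" "n \<ge> 1" "m \<ge> 1" "P \<in> V m" "Q \<in> V n" "R \<in> V k"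
  shows "ins (Suc (m + n)) k (theta (m + n) (derived m n P Q)) R =
    ins (Suc m) (n + k) (theta m P) (ins (Suc n) k (theta n Q) R)
    - (-1) ^ (m * n) *s ins (Suc n) (m + k) (theta n Q) (ins (Suc m) k (theta m P) R)"
  using assms by (simp add: theta_derived ins_commutator theta_closed)

lemma derived_skew:
  assumes "m \<ge> 1" "n \<ge> 1" "P \<in> V m" "Q \<in> V n"
  shows "derived m n P Q = - ((-1) ^ (m * n) *s derived n m Q P)"
  using br_skew[OF assms]
  by (cases "even (m * n)") (simp_all add: derived_def mult.commute)

text \<open>
  Each double bracket is expanded into cup brackets and insertions. The terms in which
  \<open>theta (derived _ _ _ _)\<close> is inserted are rewritten as commutators by \<open>ins_theta_derived\<close>; insertions
  into a cup bracket are expanded by the derivation property. What remains is the Jacobi identity of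
  the cup bracket and terms that cancel in pairs.
\<close>

lemma derived_jacobi:
  assumes mnk: "m \<ge> 1" "n \<ge> 1" "k \<ge> 1" and PQR: "P \<in> V m" "Q \<in> V n" "R \<in> V k"
  shows "derived m (n + k) P (derived n k Q R) =
              derived (m + n) k (derived m n P Q) R + (-1) ^ (m * n) *s derived n (m + k) Q (derived m k P R)"
proof -
  have TT: "theta m P \<in> V (Suc m)" "theta n Q \<in> V (Suc n)" "theta k R \<in> V (Suc k)"
    using assms by (simp_all add: theta_closed)
  have cc: "c m n P Q \<in> V (m + n)" "c m k P R \<in> V (m + k)" "c n k Q R \<in> V (n + k)"
    using assms by (simp_all add: br_closed)
  have ii: "ins (Suc m) n (theta m P) Q \<in> V (m + n)" "ins (Suc n) m (theta n Q) P \<in> V (m + n)"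
    "ins (Suc m) k (theta m P) R \<in> V (m + k)" "ins (Suc k) m (theta k R) P \<in> V (m + k)"
    "ins (Suc n) k (theta n Q) R \<in> V (n + k)" "ins (Suc k) n (theta k R) Q \<in> V (n + k)"
    using ins_closed[of n "theta m P" m Q] ins_closed[of m "theta n Q" n P]
      ins_closed[of k "theta m P" m R] ins_closed[of m "theta k R" k P]
      ins_closed[of k "theta n Q" n R] ins_closed[of n "theta k R" k Q] TT assms
    by (simp_all add: add.commute)
  note cl = assms TT cc ii V_closed
  have L: "derived m (n + k) P (derived n k Q R) =
     c m (n + k) P (c n k Q R) + c m (n + k) P (ins (Suc n) k (theta n Q) R)
     - (-1) ^ (n * k) *s c m (n + k) P (ins (Suc k) n (theta k R) Q)
     + ins (Suc m) (n + k) (theta m P) (c n k Q R)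
     + ins (Suc m) (n + k) (theta m P) (ins (Suc n) k (theta n Q) R)
     - (-1) ^ (n * k) *s ins (Suc m) (n + k) (theta m P) (ins (Suc k) n (theta k R) Q)
     - (-1) ^ (m * (n + k)) *s (ins (Suc n) (m + k) (theta n Q) (ins (Suc k) m (theta k R) P)
        - (-1) ^ (n * k) *s ins (Suc k) (m + n) (theta k R) (ins (Suc n) m (theta n Q) P))"
    unfolding derived_def[of m "n + k"] using ins_theta_derived[of m k n Q R P] cl
    by (simp add: add.commute[of k m] add.commute[of n m])
      (simp add: derived_def c_lin ins_lin cl)
  have M: "derived (m + n) k (derived m n P Q) R =
     c (m + n) k (c m n P Q) R + c (m + n) k (ins (Suc m) n (theta m P) Q) R
     - (-1) ^ (m * n) *s c (m + n) k (ins (Suc n) m (theta n Q) P) R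
     + (ins (Suc m) (n + k) (theta m P) (ins (Suc n) k (theta n Q) R)
        - (-1) ^ (m * n) *s ins (Suc n) (m + k) (theta n Q) (ins (Suc m) k (theta m P) R))
     - (-1) ^ ((m + n) * k) *s (ins (Suc k) (m + n) (theta k R) (c m n P Q)
       + ins (Suc k) (m + n) (theta k R) (ins (Suc m) n (theta m P) Q)
       - (-1) ^ (m * n) *s ins (Suc k) (m + n) (theta k R) (ins (Suc n) m (theta n Q) P))"
    unfolding derived_def[of "m + n" k] using ins_theta_derived[of k n m P Q R] cl
    by simp (simp add: derived_def c_lin ins_lin cl)
  have N: "derived n (m + k) Q (derived m k P R) =
     c n (m + k) Q (c m k P R) + c n (m + k) Q (ins (Suc m) k (theta m P) R)
     - (-1) ^ (m * k) *s c n (m + k) Q (ins (Suc k) m (theta k R) P)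
     + ins (Suc n) (m + k) (theta n Q) (c m k P R)
     + ins (Suc n) (m + k) (theta n Q) (ins (Suc m) k (theta m P) R)
     - (-1) ^ (m * k) *s ins (Suc n) (m + k) (theta n Q) (ins (Suc k) m (theta k R) P)
     - (-1) ^ (n * (m + k)) *s (ins (Suc m) (n + k) (theta m P) (ins (Suc k) n (theta k R) Q)
        - (-1) ^ (m * k) *s ins (Suc k) (m + n) (theta k R) (ins (Suc m) n (theta m P) Q))"
    unfolding derived_def[of n "m + k"] using ins_theta_derived[of n k m P R Q] cl
    by (simp add: add.commute[of k n])
      (simp add: derived_def c_lin ins_lin cl)
  have d1: "ins (Suc m) (n + k) (theta m P) (c n k Q R) = c (m + n) k (ins (Suc m) n (theta m P) Q) R
       + (-1) ^ (m * n) *s c n (m + k) Q (ins (Suc m) k (theta m P) R)"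
    using cl by (simp add: ins_derivation)
  have d2: "ins (Suc n) (m + k) (theta n Q) (c m k P R) = c (m + n) k (ins (Suc n) m (theta n Q) P) R
       + (-1) ^ (n * m) *s c m (n + k) P (ins (Suc n) k (theta n Q) R)"
    using cl by (simp add: ins_derivation add.commute[of n m])
  have d3: "ins (Suc k) (m + n) (theta k R) (c m n P Q) = c (m + k) n (ins (Suc k) m (theta k R) P) Q
       + (-1) ^ (k * m) *s c m (n + k) P (ins (Suc k) n (theta k R) Q)"
    using cl by (simp add: ins_derivation add.commute[of k])
  have s3: "c (m + k) n (ins (Suc k) m (theta k R) P) Q = - ((-1) ^ ((m + k) * n) *s
      c n (m + k) Q (ins (Suc k) m (theta k R) P))"
    using cl by (intro br_skew) simp_all
  show ?thesis
    unfolding L M N d1 d2 d3 s3 br_jacobi[OF assms]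
    by (cases "even m"; cases "even n"; cases "even k") (simp_all add: algebra_simps)
qed

lemma derived_graded_lie_algebra: "graded_lie_algebra scale V derived"
proof
  fix m n :: nat and P P' Q assume *: "m \<ge> 1" "n \<ge> 1" "P \<in> V m" "P' \<in> V m" "Q \<in> V n"
  thus "derived m n (P + P') Q = derived m n P Q + derived m n P' Q"
    using theta_closed by (simp add: derived_def theta_add br_add_left ins_add_left ins_add_right algebra_simps)
next
  fix m n :: nat and P Q a assume *: "m \<ge> 1" "n \<ge> 1" "P \<in> V m" "Q \<in> V n"
  thus "derived m n (a *s P) Q = a *s derived m n P Q"
    using theta_closed
    by (simp add: derived_def theta_scale br_scale_left ins_scale_left ins_scale_right algebra_simps)
next
  fix m n :: nat and P Q Q' assume *: "m \<ge> 1" "n \<ge> 1" "P \<in> V m" "Q \<in> V n" "Q' \<in> V n"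
  thus "derived m n P (Q + Q') = derived m n P Q + derived m n P Q'"
    using theta_closed by (simp add: derived_def theta_add br_add_right ins_add_left ins_add_right algebra_simps)
next
  fix m n :: nat and P Q a assume *: "m \<ge> 1" "n \<ge> 1" "P \<in> V m" "Q \<in> V n"
  thus "derived m n P (a *s Q) = a *s derived m n P Q"
    using theta_closed
    by (simp add: derived_def theta_scale br_scale_right ins_scale_left ins_scale_right algebra_simps)
qed (rule subspace_V derived_closed derived_skew derived_jacobi; assumption)+

text \<open>
  The Jacobi identity for \<open>P\<close>, \<open>e\<close> and \<open>e\<close>, since \<open>c(e, e) = 2\<mu>\<close>.
\<close>

lemma c_mu:
  assumes "m \<ge> 1" "P \<in> V m"
  shows "c m 2 P mu = c (m + 1) 1 (c m 1 P e) e"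
proof (rule scale_two_cancel)
  have "2 *s c m 2 P mu = c m (1 + 1) P (c 1 1 e e)"
    using assms mu_closed by (simp add: c_e_e numeral_2_eq_2[symmetric] br_scale_right)
  also have "\<dots> = c (m + 1) 1 (c m 1 P e) e + (-1) ^ m *s c 1 (m + 1) e (c m 1 P e)"
    using br_jacobi[of m 1 1 P e e] assms e_closed by simp
  also have "\<dots> = 2 *s c (m + 1) 1 (c m 1 P e) e"
    using br_skew[of 1 "m + 1" e "c m 1 P e"] assms e_closed br_closed[of m 1 P e]
    by (cases "even m") (simp_all add: scale_two)
  finally show "2 *s c m 2 P mu = 2 *s c (m + 1) 1 (c m 1 P e) e" .
qed

text \<open>
  With \<open>z = c(c(e, e), e)\<close>, skew symmetry gives \<open>c(e, c(e, e)) = - z\<close> and the Jacobi identity gives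
  \<open>c(e, c(e, e)) = z + z\<close>, so \<open>3 z = 0\<close>. For cochains the vanishing of \<open>i\<^sub>\<mu> \<mu>\<close> is the Hom-Jacobi
  identity of the bracket itself.
\<close>

lemma ins_mu_mu: "ins 2 2 mu mu = 0"
proof -
  let ?z = "c 2 1 (c 1 1 e e) e"
  have cee: "c 1 1 e e \<in> V 2" using br_closed[of 1 1 e e] e_closed by (simp add: numeral_2_eq_2)
  have "c 1 2 e (c 1 1 e e) = ?z - c 1 2 e (c 1 1 e e)"
    using br_jacobi[of 1 1 1 e e e] e_closed by (simp add: numeral_2_eq_2)
  moreover have "c 1 2 e (c 1 1 e e) = - ?z"
    using br_skew[of 1 2 e "c 1 1 e e"] e_closed cee by simp
  ultimately have "- ?z = ?z + ?z" by (metis diff_minus_eq_add)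
  hence "?z + ?z + ?z = 0" by (metis left_minus)
  hence "(3::'k) *s ?z = 0"
    using scale_left_distrib[of 1 2 ?z] by (simp add: scale_two add.assoc)
  hence "?z = 0" by simp
  moreover have "?z = 2 *s c 2 1 mu e"
    using mu_closed e_closed br_scale_left[of 2 1 mu e 2] by (simp add: c_e_e)
  ultimately have "c 2 1 mu e = 0" by simp
  thus ?thesis using ins_mu[of mu 1] mu_closed by (simp add: numeral_2_eq_2)
qed

text \<open>
  \<open>theta\<close> intertwines \<open>i\<^sub>\<mu>\<close> with the Nijenhuis-Richardson bracket by \<open>\<mu>\<close>. The two terms
  \<open>c(P, \<mu>)\<close> and \<open>i\<^bsub>theta P\<^esub> \<mu> = c(theta P, e)\<close> that separate both sides are the same up to sign by
  \<open>c_mu\<close>.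
\<close>

lemma theta_ins_mu:
  assumes "m \<ge> 1" "P \<in> V m"
  shows "theta (m + 1) (ins 2 m mu P) = ins 2 (m + 1) mu (theta m P) - (-1) ^ m *s ins (m + 1) 2 (theta m P) mu"
proof -
  have mu: "mu \<in> V (Suc 1)" using mu_closed by (simp add: numeral_2_eq_2)
  have iP: "ins 2 m mu P \<in> V (Suc m)" using ins_closed[of m mu 1 P] mu assms by (simp add: numeral_2_eq_2)
  have cP: "c m 1 P e \<in> V (Suc m)" using br_closed[of m 1 P e] assms e_closed by simp
  have "ins 2 (m + 1) mu (theta m P) = - ins 2 (m + 1) mu (c m 1 P e)"
    using assms mu cP ins_neg_right[of "Suc m" mu 1] by (simp add: theta_eq numeral_2_eq_2)
  also have "\<dots> = theta (m + 1) (ins 2 m mu P) - (-1) ^ m *s c m 2 P mu"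
    using ins_derivation[of m 1 mu 1 P e] assms mu e_closed ins_e[of mu 1] iP
    by (simp add: numeral_2_eq_2 theta_eq)
  finally show ?thesis
    using ins_mu[of "theta m P" m] theta_closed[of m P] assms cP e_closed
    by (simp add: c_mu) (simp add: theta_eq c_neg_left)
qed

text \<open>
  The operator \<open>i\<^sub>\<mu>\<close> is a derivation of the cup bracket, and moving it past \<open>i\<^bsub>theta P\<^esub>\<close> costs insertion
  of \<open>{\<mu>, theta P}\<close>, which is insertion of \<open>theta (i\<^sub>\<mu> P)\<close>. So the three parts of the derived bracket
  are differentiated term by term.
\<close>

lemma ins_mu_derivation:
  assumes mn: "m \<ge> 1" "n \<ge> 1" and PQ: "P \<in> V m" "Q \<in> V n"
  shows "ins 2 (m + n) mu (derived m n P Q) =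
    derived (m + 1) n (ins 2 m mu P) Q + (-1) ^ m *s derived m (n + 1) P (ins 2 n mu Q)"
proof -
  have mu: "mu \<in> V (Suc 1)" using mu_closed by (simp add: numeral_2_eq_2)
  have iP: "ins 2 m mu P \<in> V (Suc m)" "ins 2 n mu Q \<in> V (Suc n)"
    using ins_closed[of m mu 1 P] ins_closed[of n mu 1 Q] mu assms by (simp_all add: numeral_2_eq_2)
  have *: "ins 2 (m + n) mu (ins (Suc m) n (theta m P) Q) =
     ins (Suc (m + 1)) n (theta (m + 1) (ins 2 m mu P)) Q
     + (-1) ^ m *s ins (Suc m) (n + 1) (theta m P) (ins 2 n mu Q)"
    if "m \<ge> 1" "n \<ge> 1" "P \<in> V m" "Q \<in> V n" for m n P Q
    using ins_commutator[of n mu 1 "theta m P" m Q] that mu theta_closed[of m P] theta_ins_mu[of m P]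
    by (simp add: numeral_2_eq_2 add.commute)
  have ii: "ins (Suc m) n (theta m P) Q \<in> V (m + n)" "ins (Suc n) m (theta n Q) P \<in> V (m + n)" "c m n P Q \<in> V (m + n)"
    using ins_closed[of n "theta m P" m Q] ins_closed[of m "theta n Q" n P] theta_closed assms br_closed
    by (simp_all add: add.commute)
  have "ins 2 (m + n) mu (derived m n P Q) = ins 2 (m + n) mu (c m n P Q)
     + ins 2 (m + n) mu (ins (Suc m) n (theta m P) Q)
     - (-1) ^ (m * n) *s ins 2 (n + m) mu (ins (Suc n) m (theta n Q) P)"
    using assms mu ii ins_add_right[of "m + n" mu 1] ins_diff_right[of "m + n" mu 1]
       ins_scale_right[of "m + n" mu 1]
    by (simp add: derived_def numeral_2_eq_2 V_closed add.commute)
  also have "ins 2 (m + n) mu (c m n P Q) = c (m + 1) n (ins 2 m mu P) Q + (-1) ^ m *s c m (n + 1) P (ins 2 n mu Q)"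
    using ins_derivation[of m n mu 1 P Q] assms mu by (simp add: numeral_2_eq_2)
  finally show ?thesis
    unfolding *[OF assms] *[OF mn(2) mn(1) PQ(2) PQ(1)]
    by (cases "even m"; cases "even n") (simp_all add: derived_def algebra_simps)
qed

lemma derived_dg_lie_algebra: "dg_lie_algebra scale V derived (\<lambda>n P. - a *s ins 2 n mu P)"
proof -
  interpret D: graded_lie_algebra scale V derived by (rule derived_graded_lie_algebra)
  have mu: "mu \<in> V (Suc 1)" using mu_closed by (simp add: numeral_2_eq_2)
  have iP: "ins 2 m mu P \<in> V (Suc m)" if "m \<ge> 1" "P \<in> V m" for m P
    using ins_closed[of m mu 1 P] mu that by (simp add: numeral_2_eq_2)
  have i2: "2 = Suc 1" by simp
  show ?thesis
  proof
    fix n :: nat and P assume *: "n \<ge> 1" "P \<in> V n"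
    show "- a *s ins 2 n mu P \<in> V (n + 1)"
      using iP[OF *] V_scale[of "n + 1" _ "- a"] by simp
    fix b show "- a *s ins 2 n mu (b *s P) = b *s (- a *s ins 2 n mu P)"
      using ins_scale_right[of n mu 1 P b] * mu by (simp add: numeral_2_eq_2)
    have "ins 2 (n + 1) mu (ins 2 n mu P) = 0"
    proof -
      have "(2::'k) *s ins 2 (n + 1) mu (ins 2 n mu P) = ins 3 n (2 *s ins 2 2 mu mu) P"
        using ins_commutator[of n mu 1 mu 1 P] mu *
        by (simp add: numeral_2_eq_2 numeral_3_eq_3 scale_two[unfolded numeral_2_eq_2])
      \<comment> \<open>written as a multiple of 0, to which linearity of \<open>ins\<close> applies\<close>
      also have "\<dots> = ins (Suc 2) n (0 *s 0) P"
        by (simp add: ins_mu_mu)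
      also have "\<dots> = 0"
        using ins_scale_left[of n "0" 2 P 0] * subspace_0[OF subspace_V[of "Suc 2"]] by simp
      finally show ?thesis by simp
    qed
    thus "- a *s ins 2 (n + 1) mu (- a *s ins 2 n mu P) = 0"
      using ins_scale_right[of "n + 1" mu 1 "ins 2 n mu P" "- a"] mu iP[OF *]
        ins_neg_right[of "n + 1" mu 1 "a *s ins 2 n mu P"] V_scale[of "Suc n"]
        ins_scale_right[of "n + 1" mu 1 "ins 2 n mu P" a]
      by (simp add: numeral_2_eq_2)
  next
    fix n :: nat and P P' assume *: "n \<ge> 1" "P \<in> V n" "P' \<in> V n"
    show "- a *s ins 2 n mu (P + P') = - a *s ins 2 n mu P + - a *s ins 2 n mu P'"
      using ins_add_right[of n mu 1 P P'] * mu by (simp add: numeral_2_eq_2 algebra_simps)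
  next
    show "graded_derivation scale V derived (\<lambda>n P. - a *s ins 2 n mu P)"
      unfolding graded_derivation_def
    proof (intro allI impI ballI)
      fix m n :: nat and P Q assume *: "m \<ge> 1" "n \<ge> 1" "P \<in> V m" "Q \<in> V n"
      show "- a *s ins 2 (m + n) mu (derived m n P Q) =
        derived (m + 1) n (- a *s ins 2 m mu P) Q + (- 1) ^ m *s derived m (n + 1) P (- a *s ins 2 n mu Q)"
        using ins_mu_derivation[OF *] * iP D.br_scale_left[of "m + 1" n "ins 2 m mu P" Q "- a"]
          D.br_scale_right[of m "n + 1" P "ins 2 n mu Q" "- a"]
        by (simp add: algebra_simps del: scale_minus_left)
    qed
  qed
qed

end

section \<open>Signed unshuffles of a list\<close>

text \<open>
  Characteristic 0 makes skew functions vanish at repeated entries, as \<open>x = - x\<close> implies \<open>x = 0\<close>. A locale separate from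
  \<^locale>\<open>vector_space\<close> keeps its constants from being instantiated for real vector spaces.
\<close>

locale vector_space_char_0 = vector_space scale
  for scale :: "'k::field_char_0 \<Rightarrow> 'v::ab_group_add \<Rightarrow> 'v" (infixr \<open>*s\<close> 75)
begin

text \<open>
  The signed sum of \<open>F ys zs\<close> over all splittings of a list into complementary subsequences \<open>ys\<close> and
  \<open>zs\<close>; the sign is that of the permutation carrying the list to \<open>ys @ zs\<close>. If the first element
  goes to \<open>zs\<close>, all elements of \<open>ys\<close> come after it in the list and have to pass it: this is the
  factor \<open>(-1) ^ length ys\<close>. Dually this is the coproduct of the exterior algebra.
\<close>

primrec unshuffle :: "'x list \<Rightarrow> ('x list \<Rightarrow> 'x list \<Rightarrow> 'v) \<Rightarrow> 'v" where
  "unshuffle [] F = F [] []"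
| "unshuffle (x # xs) F =
     unshuffle xs (\<lambda>ys zs. F (x # ys) zs + scale ((-1) ^ length ys) (F ys (x # zs)))"

lemma unshuffle_cong:
  assumes "\<And>ys zs. length ys + length zs = length xs \<Longrightarrow> F ys zs = G ys zs"
  shows "unshuffle xs F = unshuffle xs G"
  using assms
proof (induction xs arbitrary: F G)
  case (Cons x xs)
  show ?case by (simp, rule Cons.IH) (simp add: Cons.prems)
qed simp

lemma unshuffle_add: "unshuffle xs (\<lambda>ys zs. F ys zs + G ys zs) = unshuffle xs F + unshuffle xs G"
proof (induction xs arbitrary: F G)
  case (Cons x xs)
  show ?case by (simp add: Cons.IH[symmetric] scale_right_distrib add_ac)
qed simp

lemma unshuffle_0: "unshuffle xs (\<lambda>ys zs. 0) = 0"
  by (induction xs) simp_all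

lemma unshuffle_linear:
  assumes "Vector_Spaces.linear scale scale h"
  shows "h (unshuffle xs F) = unshuffle xs (\<lambda>ys zs. h (F ys zs))"
proof (induction xs arbitrary: F)
  interpret Vector_Spaces.linear scale scale h by fact
  case (Cons x xs)
  thus ?case by (simp add: add scale)
qed simp

lemma linear_scale: "Vector_Spaces.linear scale scale (scale a)"
  by unfold_locales (simp_all add: scale_right_distrib mult.commute)

lemma unshuffle_scale: "unshuffle xs (\<lambda>ys zs. scale a (F ys zs)) = scale a (unshuffle xs F)"
  by (rule unshuffle_linear[OF linear_scale, symmetric])

lemma unshuffle_minus: "unshuffle xs (\<lambda>ys zs. - F ys zs) = - unshuffle xs F"
  using unshuffle_scale[of xs "-1" F] by simp

lemma unshuffle_map:
  "unshuffle (map g xs) F = unshuffle xs (\<lambda>ys zs. F (map g ys) (map g zs))"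
  by (induction xs arbitrary: F) simp_all

text \<open>
  Both sides are the sum over splittings into three subsequences. The first element of the list goes
  to one of the three, giving on either side the three terms of \<open>?H\<close>.
\<close>

lemma unshuffle_coassoc:
  "unshuffle xs (\<lambda>as r. unshuffle r (G as)) =
   unshuffle xs (\<lambda>l cs. unshuffle l (\<lambda>as bs. G as bs cs))"
proof (induction xs arbitrary: G)
  case (Cons x xs)
  let ?H = "\<lambda>as bs cs. G (x # as) bs cs + (scale ((-1) ^ length as) (G as (x # bs) cs)
     + scale ((-1) ^ (length as + length bs)) (G as bs (x # cs)))"
  have "unshuffle (x # xs) (\<lambda>as r. unshuffle r (G as)) = unshuffle xs (\<lambda>as r. unshuffle r (?H as))"
    by (simp add: unshuffle_add unshuffle_scale scale_right_distrib power_add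
        flip: scale_scale)
  also have "\<dots> = unshuffle xs (\<lambda>l cs. unshuffle l (\<lambda>as bs. ?H as bs cs))"
    by (rule Cons.IH)
  also have "\<dots> = unshuffle (x # xs) (\<lambda>l cs. unshuffle l (\<lambda>as bs. G as bs cs))"
  proof -
    have "unshuffle l (\<lambda>as bs. scale ((-1) ^ (length as + length bs)) (G as bs (x # cs)))
      = scale ((-1) ^ length l) (unshuffle l (\<lambda>as bs. G as bs (x # cs)))" for l cs
      unfolding unshuffle_scale[symmetric] by (rule unshuffle_cong) simp
    thus ?thesis by (simp add: unshuffle_add add.assoc)
  qed
  finally show ?case .
qed simp

lemma unshuffle_cocomm:
  "unshuffle xs F = unshuffle xs (\<lambda>ys zs. scale ((-1) ^ (length ys * length zs)) (F zs ys))"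
proof (induction xs arbitrary: F)
  case (Cons x xs)
  show ?case
    by (simp, subst Cons.IH, rule unshuffle_cong)
      (simp add: scale_right_distrib power_add mult.commute add.commute flip: power_mult_distrib)
qed simp

definition multilinear :: "('v list \<Rightarrow> 'v) \<Rightarrow> bool"
  where "multilinear f \<longleftrightarrow> (\<forall>us vs. Vector_Spaces.linear scale scale (\<lambda>v. f (us @ v # vs)))"

definition skew :: "('x list \<Rightarrow> 'v) \<Rightarrow> bool"
  where "skew f \<longleftrightarrow> (\<forall>us a b vs. f (us @ a # b # vs) = - f (us @ b # a # vs))"

lemma multilinearD: "multilinear f \<Longrightarrow> Vector_Spaces.linear scale scale (\<lambda>v. f (us @ v # vs))"
  by (simp add: multilinear_def)

lemma skewD: "skew f \<Longrightarrow> f (us @ a # b # vs) = - f (us @ b # a # vs)"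
  unfolding skew_def by blast

lemma
  assumes "Vector_Spaces.linear scale scale f"
  shows linear_map_add: "f (x + y) = f x + f y"
    and linear_map_0: "f 0 = 0"
    and linear_map_neg: "f (- x) = - f x"
    and linear_map_scale: "f (a *s x) = a *s f x"
proof -
  interpret f: Vector_Spaces.linear scale scale f by fact
  show "f (x + y) = f x + f y" "f 0 = 0" "f (- x) = - f x" "f (a *s x) = a *s f x"
    by (rule f.add f.zero f.neg f.scale)+
qed

lemma linear_0: "Vector_Spaces.linear scale scale (\<lambda>v. 0)"
  by unfold_locales simp_all

lemma linear_comp:
  assumes "Vector_Spaces.linear scale scale f" "Vector_Spaces.linear scale scale g"
  shows "Vector_Spaces.linear scale scale (\<lambda>v. g (f v))"
  using Vector_Spaces.linear_compose[OF assms] by (simp add: o_def)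

lemma linear_comp_add:
  assumes "Vector_Spaces.linear scale scale f" "Vector_Spaces.linear scale scale g"
  shows "Vector_Spaces.linear scale scale (\<lambda>v. f v + g v)"
proof -
  interpret f: Vector_Spaces.linear scale scale f by fact
  interpret g: Vector_Spaces.linear scale scale g by fact
  show ?thesis by unfold_locales (simp_all add: f.add g.add f.scale g.scale scale_right_distrib)
qed

lemma linear_comp_scale:
  assumes "Vector_Spaces.linear scale scale f"
  shows "Vector_Spaces.linear scale scale (\<lambda>v. scale a (f v))"
proof -
  interpret f: Vector_Spaces.linear scale scale f by fact
  show ?thesis by unfold_locales (simp_all add: f.add f.scale scale_right_distrib mult.commute)
qed

lemma linear_unshuffle_Cons:
  assumes "\<And>ys zs. Vector_Spaces.linear scale scale (\<lambda>v. F v ys zs)"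
  shows "Vector_Spaces.linear scale scale (\<lambda>v. unshuffle xs (F v))"
  using assms
proof (induction xs arbitrary: F)
  case (Cons x xs)
  show ?case by (simp, rule Cons.IH) (intro linear_comp_add linear_comp_scale Cons.prems)
qed simp

lemma multilinear_unshuffle:
  assumes "\<And>zs. multilinear (\<lambda>ys. F ys zs)" "\<And>ys. multilinear (F ys)"
  shows "multilinear (\<lambda>xs. unshuffle xs F)"
  unfolding multilinear_def
proof (intro allI)
  fix us vs
  show "Vector_Spaces.linear scale scale (\<lambda>v. unshuffle (us @ v # vs) F)"
    using assms
  proof (induction us arbitrary: F)
    case Nil
    have "Vector_Spaces.linear scale scale (\<lambda>v. F (v # ys) zs)"
      "Vector_Spaces.linear scale scale (\<lambda>v. F ys (v # zs))" for ys zs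
      using multilinearD[OF Nil(1), where us = "[]"] multilinearD[OF Nil(2), where us = "[]"] by simp_all
    thus ?case
      by (simp, intro linear_unshuffle_Cons linear_comp_add linear_comp_scale)
  next
    case (Cons x us)
    show ?case
    proof (simp, rule Cons.IH)
      fix zs :: "'v list"
      show "multilinear (\<lambda>ys. F (x # ys) zs + scale ((- 1) ^ length ys) (F ys (x # zs)))"
        unfolding multilinear_def
      proof (intro allI linear_comp_add)
        fix us vs
        show "Vector_Spaces.linear scale scale (\<lambda>v. F (x # us @ v # vs) zs)"
          using multilinearD[OF Cons.prems(1), where us = "x # us"] by simp
        show "Vector_Spaces.linear scale scale
           (\<lambda>v. scale ((- 1) ^ length (us @ v # vs)) (F (us @ v # vs) (x # zs)))"
          unfolding length_append length_Cons by (rule linear_comp_scale[OF multilinearD[OF Cons.prems(1)]])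
      qed
      fix ys :: "'v list"
      show "multilinear (\<lambda>zs. F (x # ys) zs + scale ((- 1) ^ length ys) (F ys (x # zs)))"
        unfolding multilinear_def
      proof (intro allI linear_comp_add linear_comp_scale)
        fix us vs
        show "Vector_Spaces.linear scale scale (\<lambda>v. F (x # ys) (us @ v # vs))"
          by (rule multilinearD[OF Cons.prems(2)])
        show "Vector_Spaces.linear scale scale (\<lambda>v. F ys (x # us @ v # vs))"
          using multilinearD[OF Cons.prems(2), where us = "x # us"] by simp
      qed
    qed
  qed
qed

text \<open>
  For two adjacent elements \<open>a\<close>, \<open>b\<close> at the front there are four terms: if both go to the same
  subsequence, skewness of \<open>F\<close> applies; if they are separated, the two mixed terms are exchanged with
  opposite signs by the extra element that has to be passed.
\<close>

lemma skew_unshuffle: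
  assumes "\<And>zs. skew (\<lambda>ys. F ys zs)" "\<And>ys. skew (F ys)"
  shows "skew (\<lambda>xs. unshuffle xs F)"
  unfolding skew_def
proof (intro allI)
  fix us a b vs
  show "unshuffle (us @ a # b # vs) F = - unshuffle (us @ b # a # vs) F"
    using assms
  proof (induction us arbitrary: F)
    case Nil
    have 1: "F (a # b # ys) zs = - F (b # a # ys) zs" "F ys (a # b # zs) = - F ys (b # a # zs)" for ys zs
      using skewD[OF Nil(1), where us = "[]"] skewD[OF Nil(2), where us = "[]"] unfolding append_Nil by blast+
    show ?case
      unfolding append_Nil unshuffle.simps unshuffle_minus[symmetric]
      by (rule unshuffle_cong) (simp add: 1 algebra_simps)
  next
    case (Cons x us)
    show ?case
    proof (simp, rule Cons.IH)
      fix zs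
      show "skew (\<lambda>ys. F (x # ys) zs + scale ((- 1) ^ length ys) (F ys (x # zs)))"
        unfolding skew_def
      proof (intro allI)
        fix us a b vs
        have "F (x # us @ a # b # vs) zs = - F (x # us @ b # a # vs) zs"
          "F (us @ a # b # vs) (x # zs) = - F (us @ b # a # vs) (x # zs)"
          using skewD[OF Cons.prems(1), where us = "x # us"] skewD[OF Cons.prems(1)] unfolding append_Cons by blast+
        thus "F (x # us @ a # b # vs) zs + scale ((- 1) ^ length (us @ a # b # vs)) (F (us @ a # b # vs) (x # zs))
         = - (F (x # us @ b # a # vs) zs + scale ((- 1) ^ length (us @ b # a # vs)) (F (us @ b # a # vs) (x # zs)))"
          by simp
      qed
      fix ys
      show "skew (\<lambda>zs. F (x # ys) zs + scale ((- 1) ^ length ys) (F ys (x # zs)))"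
        unfolding skew_def
      proof (intro allI)
        fix us a b vs
        have "F (x # ys) (us @ a # b # vs) = - F (x # ys) (us @ b # a # vs)"
          "F ys (x # us @ a # b # vs) = - F ys (x # us @ b # a # vs)"
          using skewD[OF Cons.prems(2), where us = "x # us"] skewD[OF Cons.prems(2)] unfolding append_Cons by blast+
        thus "F (x # ys) (us @ a # b # vs) + scale ((- 1) ^ length ys) (F ys (x # us @ a # b # vs))
         = - (F (x # ys) (us @ b # a # vs) + scale ((- 1) ^ length ys) (F ys (x # us @ b # a # vs)))"
          by simp
      qed
    qed
  qed
qed

end

section \<open>Unshuffles and shuffle permutations\<close>

text \<open>
  Shuffles are enumerated recursively by the position that is sent to 0, which is the first position
  of one of the two blocks. In the first block the shuffle is \<open>shift_perm \<tau>\<close> for a smaller shuffle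
  \<open>\<tau>\<close>. In the second block, starting at \<open>m\<close>, it is \<open>shift_perm \<tau>\<close> preceded by the cycle
  \<open>front_cycle m\<close> that moves position \<open>m\<close> to the front.
\<close>

definition shift_perm :: "(nat \<Rightarrow> nat) \<Rightarrow> nat \<Rightarrow> nat"
  where "shift_perm \<tau> i = (case i of 0 \<Rightarrow> 0 | Suc j \<Rightarrow> Suc (\<tau> j))"

lemma shift_perm_simps [simp]: "shift_perm \<tau> 0 = 0" "shift_perm \<tau> (Suc j) = Suc (\<tau> j)"
  by (simp_all add: shift_perm_def)

definition front_cycle :: "nat \<Rightarrow> nat \<Rightarrow> nat"
  where "front_cycle m i = (if i < m then Suc i else if i = m then 0 else i)"

lemma front_cycle_Suc: "front_cycle (Suc m) = front_cycle m \<circ> Transposition.transpose m (Suc m)"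
  by (auto simp: front_cycle_def Transposition.transpose_def fun_eq_iff)

lemma front_cycle_permutes: "front_cycle m permutes {..m}"
proof (induction m)
  case 0
  have "front_cycle 0 = id" by (auto simp: front_cycle_def)
  show ?case unfolding \<open>front_cycle 0 = id\<close> by (rule permutes_id)
next
  case (Suc m)
  show ?case unfolding front_cycle_Suc
    by (intro permutes_compose permutes_swap_id permutes_subset[OF Suc]) auto
qed

lemma sign_front_cycle: "sign (front_cycle m) = (-1) ^ m"
proof (induction m)
  case 0
  have "front_cycle 0 = id" by (auto simp: front_cycle_def)
  thus ?case by simp
next
  case (Suc m)
  have "permutation (front_cycle m)"
    using front_cycle_permutes permutation_permutes finite_atMost by blast
  hence "sign (front_cycle m \<circ> Transposition.transpose m (Suc m)) =
      sign (front_cycle m) * sign (Transposition.transpose m (Suc m))"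
    by (intro sign_compose permutation_swap_id)
  thus ?case unfolding front_cycle_Suc by (simp only: Suc) (simp add: sign_swap_id)
qed

lemma shift_perm_permutes:
  assumes "\<tau> permutes {..<n}"
  shows "shift_perm \<tau> permutes {..<Suc n}" "sign (shift_perm \<tau>) = sign \<tau>"
proof -
  have eq: "shift_perm \<tau> = map_permutation {..<n} Suc \<tau>"
  proof
    fix i show "shift_perm \<tau> i = map_permutation {..<n} Suc \<tau> i"
      using assms permutes_not_in[OF assms] inv_into_f_f[of Suc "{..<n}"]
      by (cases i) (auto simp: map_permutation_def restrict_id_def)
  qed
  have "shift_perm \<tau> permutes Suc ` {..<n}"
    unfolding eq by (rule map_permutation_permutes) (auto simp: bij_betw_def assms)
  thus "shift_perm \<tau> permutes {..<Suc n}" by (rule permutes_subset) auto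
  show "sign (shift_perm \<tau>) = sign \<tau>"
    unfolding eq by (rule sign_map_permutation) (auto simp: assms)
qed

lemma inj_shift_perm: "inj shift_perm"
proof (rule injI)
  fix \<sigma> \<tau> assume "shift_perm \<sigma> = shift_perm \<tau>"
  hence "shift_perm \<sigma> (Suc i) = shift_perm \<tau> (Suc i)" for i by simp
  thus "\<sigma> = \<tau>" by auto
qed

lemma shift_perm_surj:
  assumes "\<sigma> permutes {..<Suc n}" "\<sigma> 0 = 0"
  obtains \<tau> where "\<tau> permutes {..<n}" "\<sigma> = shift_perm \<tau>"
proof
  define \<tau> where "\<tau> = (\<lambda>i. \<sigma> (Suc i) - 1)"
  have pos: "\<sigma> (Suc i) \<noteq> 0" for i
    using assms by (metis nat.distinct(1) permutes_inj injD)
  show "\<sigma> = shift_perm \<tau>"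
    using assms(2) pos by (auto simp: shift_perm_def \<tau>_def fun_eq_iff split: nat.splits)
  have inj: "inj \<tau>"
  proof (rule injI)
    fix i j assume "\<tau> i = \<tau> j"
    hence "\<sigma> (Suc i) = \<sigma> (Suc j)" using pos[of i] pos[of j] by (simp add: \<tau>_def)
    thus "i = j" using permutes_inj[OF assms(1)] by (simp add: inj_eq)
  qed
  have out: "\<tau> i = i" if "i \<notin> {..<n}" for i
    using permutes_not_in[OF assms(1), of "Suc i"] that by (simp add: \<tau>_def)
  have "\<tau> ` {..<n} \<subseteq> {..<n}"
  proof
    fix j assume "j \<in> \<tau> ` {..<n}"
    then obtain i where i: "i < n" "j = \<tau> i" by auto
    have "\<sigma> (Suc i) < Suc n" using permutes_in_image[OF assms(1), of "Suc i"] i by simp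
    thus "j \<in> {..<n}" using i pos[of i] by (simp add: \<tau>_def)
  qed
  hence "\<tau> ` {..<n} = {..<n}"
    using inj by (intro endo_inj_surj) (auto intro: inj_on_subset)
  thus "\<tau> permutes {..<n}"
    using inj out by (intro bij_imp_permutes bij_betw_imageI) (auto intro: inj_on_subset)
qed

lemma finite_shuffles_perm [simp]: "finite (shuffles_perm m n)"
  by (rule finite_subset[OF _ finite_permutations[of "{..<m+n}"]]) (auto simp: shuffles_perm_def)

lemma shuffles_perm_first_block:
  "{\<sigma> \<in> shuffles_perm (Suc m) n. \<sigma> 0 = 0} = shift_perm ` shuffles_perm m n"
proof (intro set_eqI iffI)
  fix \<sigma> assume "\<sigma> \<in> {\<sigma> \<in> shuffles_perm (Suc m) n. \<sigma> 0 = 0}"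
  hence *: "\<sigma> permutes {..<Suc (m + n)}" "\<sigma> 0 = 0" "strict_mono_on {..<Suc m} \<sigma>"
    "strict_mono_on {Suc m..<Suc m + n} \<sigma>" by (auto simp: shuffles_perm_def)
  then obtain \<tau> where \<tau>: "\<tau> permutes {..<m + n}" "\<sigma> = shift_perm \<tau>" by (elim shift_perm_surj)
  have "strict_mono_on {..<m} \<tau>" "strict_mono_on {m..<m + n} \<tau>"
    using strict_mono_onD[OF *(3), of "Suc _" "Suc _"] strict_mono_onD[OF *(4), of "Suc _" "Suc _"]
    by (auto intro!: strict_mono_onI simp: \<tau>(2))
  thus "\<sigma> \<in> shift_perm ` shuffles_perm m n" using \<tau> by (auto simp: shuffles_perm_def)
next
  fix \<sigma> assume "\<sigma> \<in> shift_perm ` shuffles_perm m n"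
  then obtain \<tau> where \<tau>: "\<tau> permutes {..<m + n}" "\<sigma> = shift_perm \<tau>"
    "strict_mono_on {..<m} \<tau>" "strict_mono_on {m..<m + n} \<tau>" by (auto simp: shuffles_perm_def)
  have "strict_mono_on {..<Suc m} \<sigma>"
    using strict_mono_onD[OF \<tau>(3)]
    by (intro strict_mono_onI) (auto simp: \<tau>(2) shift_perm_def split: nat.splits)
  moreover have "strict_mono_on {Suc m..<Suc m + n} \<sigma>"
    using strict_mono_onD[OF \<tau>(4)]
    by (intro strict_mono_onI) (auto simp: \<tau>(2) shift_perm_def split: nat.splits)
  ultimately show "\<sigma> \<in> {\<sigma> \<in> shuffles_perm (Suc m) n. \<sigma> 0 = 0}"
    using shift_perm_permutes(1)[OF \<tau>(1)] \<tau>(2) by (simp add: shuffles_perm_def)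
qed

lemma shuffles_perm_second_block:
  "{\<sigma> \<in> shuffles_perm m (Suc n). \<sigma> m = 0} = (\<lambda>\<tau>. shift_perm \<tau> \<circ> front_cycle m) ` shuffles_perm m n"
proof (intro set_eqI iffI)
  let ?c = "front_cycle m"
  have c: "?c permutes {..<Suc (m + n)}" by (rule permutes_subset[OF front_cycle_permutes]) auto
  {
    fix \<sigma> assume "\<sigma> \<in> {\<sigma> \<in> shuffles_perm m (Suc n). \<sigma> m = 0}"
    hence *: "\<sigma> permutes {..<Suc (m + n)}" "\<sigma> m = 0" "strict_mono_on {..<m} \<sigma>"
      "strict_mono_on {m..<Suc (m + n)} \<sigma>" by (auto simp: shuffles_perm_def)
    have "?c m = 0" by (simp add: front_cycle_def)
    hence "inv ?c 0 = m" using permutes_inv_eq[OF c] by blast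
    hence "(\<sigma> \<circ> inv ?c) 0 = 0" using *(2) by simp
    moreover have "\<sigma> \<circ> inv ?c permutes {..<Suc (m + n)}"
      by (intro permutes_compose permutes_inv c *)
    ultimately obtain \<tau> where \<tau>: "\<tau> permutes {..<m + n}" "\<sigma> \<circ> inv ?c = shift_perm \<tau>"
      by (elim shift_perm_surj)
    have s: "\<sigma> = shift_perm \<tau> \<circ> ?c"
      using permutes_inv_o(2)[OF c] by (simp add: \<tau>(2)[symmetric] comp_assoc)
    have "strict_mono_on {..<m} \<tau>"
      using strict_mono_onD[OF *(3)]
      by (auto intro!: strict_mono_onI simp: s front_cycle_def)
    moreover have "strict_mono_on {m..<m + n} \<tau>"
    proof (rule strict_mono_onI)
      fix i j assume "i \<in> {m..<m + n}" "j \<in> {m..<m + n}" "i < j"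
      thus "\<tau> i < \<tau> j"
        using strict_mono_onD[OF *(4), of "Suc i" "Suc j"] by (simp add: s front_cycle_def)
    qed
    ultimately show "\<sigma> \<in> (\<lambda>\<tau>. shift_perm \<tau> \<circ> ?c) ` shuffles_perm m n"
      using \<tau> s by (auto simp: shuffles_perm_def)
  next
    fix \<sigma> assume "\<sigma> \<in> (\<lambda>\<tau>. shift_perm \<tau> \<circ> ?c) ` shuffles_perm m n"
    then obtain \<tau> where \<tau>: "\<tau> permutes {..<m + n}" "\<sigma> = shift_perm \<tau> \<circ> ?c"
      "strict_mono_on {..<m} \<tau>" "strict_mono_on {m..<m + n} \<tau>" by (auto simp: shuffles_perm_def)
    have "strict_mono_on {..<m} \<sigma>"
      using strict_mono_onD[OF \<tau>(3)]
      by (intro strict_mono_onI) (auto simp: \<tau>(2) front_cycle_def)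
    moreover have "strict_mono_on {m..<m + Suc n} \<sigma>"
      using strict_mono_onD[OF \<tau>(4)]
      by (intro strict_mono_onI) (auto simp: \<tau>(2) front_cycle_def shift_perm_def split: nat.splits)
    ultimately show "\<sigma> \<in> {\<sigma> \<in> shuffles_perm m (Suc n). \<sigma> m = 0}"
      using permutes_compose[OF c shift_perm_permutes(1)[OF \<tau>(1)]] \<tau>(2)
      by (simp add: shuffles_perm_def front_cycle_def)
  }
qed

lemma shuffles_perm_zero_position:
  assumes "\<sigma> \<in> shuffles_perm m n" "m + n > 0"
  shows "(m > 0 \<and> \<sigma> 0 = 0) \<or> (n > 0 \<and> \<sigma> m = 0)"
proof -
  have *: "\<sigma> permutes {..<m + n}" "strict_mono_on {..<m} \<sigma>" "strict_mono_on {m..<m + n} \<sigma>"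
    using assms by (auto simp: shuffles_perm_def)
  obtain i where i: "i < m + n" "\<sigma> i = 0"
    using permutes_image[OF *(1)] assms(2) by (metis imageE lessThan_iff)
  show ?thesis
  proof (cases "i < m")
    case True
    thus ?thesis using strict_mono_onD[OF *(2), of 0 i] i by (cases i) auto
  next
    case False
    thus ?thesis using strict_mono_onD[OF *(3), of m i] i by (cases "i = m") auto
  qed
qed

context vector_space_char_0 begin

text \<open>
  The two cases of the recursion for shuffles, \<open>?A\<close> and \<open>?B\<close>, are the two summands in the recursion
  for \<^const>\<open>unshuffle\<close>; the sign \<open>(-1) ^ m\<close> of \<open>front_cycle m\<close> is the sign \<open>(-1) ^ length ys\<close> there.
  The right-hand side restricts the splitting to blocks of lengths \<open>m\<close> and \<open>n\<close>.
\<close>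

lemma unshuffle_eq_sum_shuffles:
  "(\<Sum>\<sigma>\<in>shuffles_perm m n. scale (of_int (sign \<sigma>))
      (F (map (\<lambda>i. x (\<sigma> i)) [0..<m]) (map (\<lambda>i. x (\<sigma> i)) [m..<m + n]))) =
   unshuffle (map x [0..<m + n]) (\<lambda>ys zs. if length ys = m \<and> length zs = n then F ys zs else 0)"
proof (induction "m + n" arbitrary: m n x F)
  case 0
  have "shuffles_perm 0 0 = {id}" by (auto simp: shuffles_perm_def strict_mono_on_def)
  with 0 show ?case by simp
next
  case (Suc N)
  let ?f = "\<lambda>\<sigma>. scale (of_int (sign \<sigma>))
      (F (map (\<lambda>i. x (\<sigma> i)) [0..<m]) (map (\<lambda>i. x (\<sigma> i)) [m..<m + n]))"
  let ?A = "{\<sigma> \<in> shuffles_perm m n. m > 0 \<and> \<sigma> 0 = 0}"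
  let ?B = "{\<sigma> \<in> shuffles_perm m n. n > 0 \<and> \<sigma> m = 0}"
  let ?X = "map (\<lambda>i. x (Suc i)) [0..<N]"
  have mapx: "map x [0..<m + n] = x 0 # ?X"
    unfolding Suc(2)[symmetric] by (simp add: upt_conv_Cons map_Suc_upt[symmetric] del: upt_Suc)
  have A: "sum ?f ?A = unshuffle ?X
    (\<lambda>ys zs. if Suc (length ys) = m \<and> length zs = n then F (x 0 # ys) zs else 0)"
  proof (cases m)
    case 0
    thus ?thesis by (simp add: unshuffle_0)
  next
    case (Suc m')
    have "sum ?f ?A = sum ?f (shift_perm ` shuffles_perm m' n)"
      using Suc by (simp add: shuffles_perm_first_block)
    also have "\<dots> = (\<Sum>\<tau>\<in>shuffles_perm m' n. scale (of_int (sign \<tau>))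
      (F (x 0 # map (\<lambda>i. x (Suc (\<tau> i))) [0..<m']) (map (\<lambda>i. x (Suc (\<tau> i))) [m'..<m' + n])))"
    proof (subst sum.reindex, (rule inj_on_subset[OF inj_shift_perm], simp), rule sum.cong)
      fix \<tau> assume "\<tau> \<in> shuffles_perm m' n"
      hence "sign (shift_perm \<tau>) = sign \<tau>"
        by (intro shift_perm_permutes(2)) (auto simp: shuffles_perm_def)
      moreover have "map (\<lambda>i. x (shift_perm \<tau> i)) [Suc m'..<Suc (m' + n)] =
         map (\<lambda>i. x (Suc (\<tau> i))) [m'..<m' + n]"
        by (simp add: map_Suc_upt[symmetric] del: upt_Suc)
      moreover have "map (\<lambda>i. x (shift_perm \<tau> i)) [0..<Suc m'] = x 0 # map (\<lambda>i. x (Suc (\<tau> i))) [0..<m']"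
        by (simp add: upt_conv_Cons map_Suc_upt[symmetric] del: upt_Suc)
      ultimately show "(?f \<circ> shift_perm) \<tau> = scale (of_int (sign \<tau>))
        (F (x 0 # map (\<lambda>i. x (Suc (\<tau> i))) [0..<m']) (map (\<lambda>i. x (Suc (\<tau> i))) [m'..<m' + n]))"
        by (simp add: Suc del: upt_Suc map_eq_conv)
    qed simp
    also have "\<dots> = unshuffle ?X
       (\<lambda>ys zs. if length ys = m' \<and> length zs = n then F (x 0 # ys) zs else 0)"
      using Suc.hyps(1)[of m' n "\<lambda>ys. F (x 0 # ys)" "\<lambda>i. x (Suc i)"] Suc Suc.hyps(2) by simp
    finally show ?thesis using Suc by simp
  qed
  have B: "sum ?f ?B = unshuffle ?X
    (\<lambda>ys zs. scale ((-1) ^ length ys) (if length ys = m \<and> Suc (length zs) = n then F ys (x 0 # zs) else 0))"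
  proof (cases n)
    case 0
    thus ?thesis by (simp add: unshuffle_0)
  next
    case (Suc n')
    have inj: "inj (\<lambda>\<tau>. shift_perm \<tau> \<circ> front_cycle m)"
    proof (rule injI)
      fix \<sigma> \<tau> assume "shift_perm \<sigma> \<circ> front_cycle m = shift_perm \<tau> \<circ> front_cycle m"
      hence "shift_perm \<sigma> = shift_perm \<tau>"
        using permutes_surj[OF front_cycle_permutes[of m]] by (metis fun.map_comp surj_iff comp_id)
      thus "\<sigma> = \<tau>" using inj_shift_perm by (simp add: inj_eq)
    qed
    have "sum ?f ?B = sum ?f ((\<lambda>\<tau>. shift_perm \<tau> \<circ> front_cycle m) ` shuffles_perm m n')"
      using Suc by (simp add: shuffles_perm_second_block)
    also have "\<dots> = (\<Sum>\<tau>\<in>shuffles_perm m n'. scale (of_int (sign \<tau>)) (scale ((-1) ^ m)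
      (F (map (\<lambda>i. x (Suc (\<tau> i))) [0..<m]) (x 0 # map (\<lambda>i. x (Suc (\<tau> i))) [m..<m + n']))))"
    proof (subst sum.reindex, (rule inj_on_subset[OF inj], simp), rule sum.cong)
      fix \<tau> assume "\<tau> \<in> shuffles_perm m n'"
      hence t: "\<tau> permutes {..<m + n'}" by (auto simp: shuffles_perm_def)
      have "permutation (shift_perm \<tau>)" "permutation (front_cycle m)"
        using shift_perm_permutes(1)[OF t] front_cycle_permutes[of m] permutation_permutes
        by blast+
      hence "sign (shift_perm \<tau> \<circ> front_cycle m) = sign \<tau> * (-1) ^ m"
        by (simp add: sign_compose sign_front_cycle shift_perm_permutes(2)[OF t])
      moreover have "map (\<lambda>i. x (shift_perm \<tau> (front_cycle m i))) [m..<Suc (m + n')] =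
         x 0 # map (\<lambda>i. x (Suc (\<tau> i))) [m..<m + n']"
        by (simp add: upt_conv_Cons map_Suc_upt[symmetric] front_cycle_def del: upt_Suc)
      moreover have "map (\<lambda>i. x (shift_perm \<tau> (front_cycle m i))) [0..<m] = map (\<lambda>i. x (Suc (\<tau> i))) [0..<m]"
        by (simp add: front_cycle_def)
      ultimately show "(?f \<circ> (\<lambda>\<tau>. shift_perm \<tau> \<circ> front_cycle m)) \<tau> =
        scale (of_int (sign \<tau>)) (scale ((-1) ^ m)
         (F (map (\<lambda>i. x (Suc (\<tau> i))) [0..<m]) (x 0 # map (\<lambda>i. x (Suc (\<tau> i))) [m..<m + n'])))"
        by (simp add: Suc del: upt_Suc map_eq_conv)
    qed simp
    also have "\<dots> = unshuffle ?X
       (\<lambda>ys zs. if length ys = m \<and> length zs = n' then scale ((-1) ^ m) (F ys (x 0 # zs)) else 0)"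
      using Suc.hyps(1)[of m n' "\<lambda>ys zs. scale ((-1) ^ m) (F ys (x 0 # zs))" "\<lambda>i. x (Suc i)"] Suc Suc.hyps(2) by simp
    also have "\<dots> = unshuffle ?X
      (\<lambda>ys zs. scale ((-1) ^ length ys) (if length ys = m \<and> Suc (length zs) = n then F ys (x 0 # zs) else 0))"
      using Suc by (intro unshuffle_cong) simp
    finally show ?thesis .
  qed
  have "m + n > 0" using Suc(2) by linarith
  hence "\<sigma> \<in> ?A \<union> ?B" if "\<sigma> \<in> shuffles_perm m n" for \<sigma>
    using shuffles_perm_zero_position[OF that] that by simp
  hence dec: "shuffles_perm m n = ?A \<union> ?B"
    by (intro equalityI subsetI) (assumption, elim UnE, simp_all)
  have "?A \<inter> ?B = {}"
  proof -
    { fix \<sigma> assume *: "\<sigma> \<in> ?A" "\<sigma> \<in> ?B"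
      hence "\<sigma> 0 = \<sigma> m" "\<sigma> permutes {..<m + n}" by (auto simp: shuffles_perm_def)
      hence "0 = m" using permutes_inj by (metis injD)
      with * have False by simp }
    thus ?thesis by blast
  qed
  hence "sum ?f (shuffles_perm m n) = sum ?f ?A + sum ?f ?B"
    by (subst dec, intro sum.union_disjoint) auto
  thus ?case unfolding A B mapx unshuffle_add[symmetric] by simp
qed

end

section \<open>Skew multilinear functions of lists\<close>

context vector_space_char_0
begin

text \<open>
  Transposes the first two of three subsequences, by coassociativity and cocommutativity.
\<close>

lemma unshuffle_swap12:
  "unshuffle xs (\<lambda>as r. unshuffle r (G as)) =
   unshuffle xs (\<lambda>as r. unshuffle r (\<lambda>bs cs. (-1) ^ (length as * length bs) *s G bs as cs))"
  unfolding unshuffle_coassoc by (subst unshuffle_cocomm) (rule refl)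

lemma unshuffle_Nil_right: "unshuffle xs (\<lambda>ys zs. if zs = [] then f ys else 0) = f xs"
proof (induction xs arbitrary: f)
  case (Cons x xs)
  have "unshuffle (x # xs) (\<lambda>ys zs. if zs = [] then f ys else 0) =
     unshuffle xs (\<lambda>ys zs. if zs = [] then f (x # ys) else 0)"
    by simp
  thus ?case using Cons.IH[of "\<lambda>ys. f (x # ys)"] by simp
qed simp

lemma skew_move:
  assumes "skew f"
  shows "f (us @ a # vs @ ws) = (-1) ^ length vs *s f (us @ vs @ a # ws)"
proof (induction vs arbitrary: us)
  case (Cons b vs)
  have "f (us @ a # b # vs @ ws) = - f ((us @ [b]) @ a # vs @ ws)"
    using skewD[OF assms, of us a b "vs @ ws"] by simp
  also have "\<dots> = - ((-1) ^ length vs *s f ((us @ [b]) @ vs @ a # ws))"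
    by (simp only: Cons.IH)
  finally show ?case by simp
qed simp

text \<open>
  Move the first of the two equal entries next to the second; exchanging them then changes the sign
  but not the list.
\<close>

lemma skew_vanish:
  assumes "skew f" "i < j" "j < length xs" "xs ! i = xs ! j"
  shows "f xs = 0"
proof -
  obtain us a rs where 1: "xs = us @ a # rs" "length us = i"
    using id_take_nth_drop[of i xs] assms by (metis length_take min.absorb4 order.strict_trans)
  have "rs ! (j - Suc i) = a" "j - Suc i < length rs"
    using assms 1 by (auto simp: nth_append nth_Cons' Suc_diff_Suc)
  then obtain vs ws where 2: "rs = vs @ a # ws"
    using id_take_nth_drop[of "j - Suc i" rs] by metis
  let ?z = "f ((us @ vs) @ a # a # ws)"
  have "?z + ?z = 0" using skewD[OF assms(1), of "us @ vs" a a ws] by (metis left_minus)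
  hence "(2::'k) *s ?z = 0" using scale_left_distrib[of 1 1 ?z] by simp
  hence "?z = 0" by simp
  thus ?thesis using skew_move[OF assms(1), of us a vs "a # ws"] 1 2 by simp
qed

text \<open>
  Polarization: expand the vanishing value at the adjacent entries \<open>a + b\<close>, \<open>a + b\<close>.
\<close>

lemma skew_if_vanishing:
  assumes f: "multilinear f" and vanish: "\<And>us a vs. f (us @ a # a # vs) = 0"
  shows "skew f"
  unfolding skew_def
proof (intro allI)
  fix us vs :: "'v list" and a b :: 'v
  have 1: "f (us @ (x + y) # zs) = f (us @ x # zs) + f (us @ y # zs)" for x y zs
    using multilinearD[OF f, of us zs] by (rule linear_map_add)
  have 2: "f (us @ z # (x + y) # vs) = f (us @ z # x # vs) + f (us @ z # y # vs)" for x y z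
    using linear_map_add[OF multilinearD[OF f, of "us @ [z]" vs]] by simp
  have "f (us @ (a + b) # (a + b) # vs) = f (us @ a # b # vs) + f (us @ b # a # vs)"
    unfolding 1 2 by (simp add: vanish)
  thus "f (us @ a # b # vs) = - f (us @ b # a # vs)"
    by (simp add: vanish eq_neg_iff_add_eq_0)
qed

end

section \<open>Hom-Lie cochains as functions of lists\<close>

sublocale hom_lie_algebra \<subseteq> vector_space_char_0 scale ..

context hom_lie_algebra
begin

text \<open>
  Setting a cochain to 0 on lists of the wrong length makes the degree visible in the function
  itself: sums over all splittings can then be left unrestricted, and the operations on lists need no
  degree arguments.
\<close>

definition list_cochains :: "nat \<Rightarrow> ('v list \<Rightarrow> 'v) set"
  where "list_cochains n = {f. (\<forall>xs. length xs \<noteq> n \<longrightarrow> f xs = 0) \<and> multilinear f \<and> skew f \<and>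
     (\<forall>xs. f (map \<alpha> xs) = \<alpha> (f xs))}"

definition from_list :: "nat \<Rightarrow> ('v list \<Rightarrow> 'v) \<Rightarrow> (nat \<Rightarrow> 'v) \<Rightarrow> 'v"
  where "from_list n f x = f (map x [0..<n])"

lemma list_cochainsD:
  assumes "f \<in> list_cochains n"
  shows "length xs \<noteq> n \<Longrightarrow> f xs = 0" "multilinear f" "skew f" "f (map \<alpha> xs) = \<alpha> (f xs)"
  using assms by (auto simp: list_cochains_def)

lemma from_list_in_cochains:
  assumes g: "g \<in> list_cochains n"
  shows "from_list n g \<in> cochains n"
  unfolding cochains_def
proof (intro CollectI conjI allI impI)
  fix x y :: "nat \<Rightarrow> 'v" assume "\<forall>i<n. x i = y i"
  hence "map x [0..<n] = map y [0..<n]" by simp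
  thus "from_list n g x = from_list n g y" unfolding from_list_def by (rule arg_cong)
next
  fix x :: "nat \<Rightarrow> 'v" and i assume i: "i < n"
  have "map (x(i := v)) [0..<n] = map x [0..<i] @ v # map x [Suc i..<n]" for v
  proof -
    have "[0..<n] = [0..<i] @ i # [Suc i..<n]"
      using i by (metis le_add1 plus_nat.add_0 upt_add_eq_append upt_conv_Cons le_add_diff_inverse less_imp_le)
    thus ?thesis by simp
  qed
  thus "Vector_Spaces.linear (*s) (*s) (\<lambda>v. from_list n g (x(i := v)))"
    unfolding from_list_def using multilinearD[OF list_cochainsD(2)[OF g]] by presburger
next
  fix x :: "nat \<Rightarrow> 'v" assume "\<exists>i<n. \<exists>j<n. i \<noteq> j \<and> x i = x j"
  then obtain i j where "i < j" "j < n" "x i = x j" by (metis linorder_neqE_nat)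
  thus "from_list n g x = 0"
    unfolding from_list_def by (intro skew_vanish[OF list_cochainsD(3)[OF g], of i j]) simp_all
next
  fix x :: "nat \<Rightarrow> 'v"
  show "\<alpha> (from_list n g x) = from_list n g (\<lambda>i. \<alpha> (x i))"
    using list_cochainsD(4)[OF g, of "map x [0..<n]"] by (simp add: from_list_def o_def)
qed

lemma cochainsD:
  assumes "f \<in> cochains n"
  shows "(\<And>i. i < n \<Longrightarrow> x i = y i) \<Longrightarrow> f x = f y"
    and "i < n \<Longrightarrow> Vector_Spaces.linear scale scale (\<lambda>v. f (x(i := v)))"
    and "i < n \<Longrightarrow> j < n \<Longrightarrow> i \<noteq> j \<Longrightarrow> x i = x j \<Longrightarrow> f x = 0"
    and "\<alpha> (f x) = f (\<lambda>i. \<alpha> (x i))"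
  using assms unfolding cochains_def by blast+

text \<open>
  Together with \<open>from_list_in_cochains\<close> this identifies the two descriptions of cochains, so closure
  and identities need only be proved for functions of lists.
\<close>

lemma cochainE:
  assumes f: "f \<in> cochains n"
  obtains g where "g \<in> list_cochains n" "f = from_list n g"
proof
  note loc = cochainsD(1)[OF f] and lin = cochainsD(2)[OF f] and alt = cochainsD(3)[OF f] and eqv = cochainsD(4)[OF f]
  define g where "g xs = (if length xs = n then f (nth xs) else 0)" for xs
  show "f = from_list n g"
    by (rule ext) (auto simp: from_list_def g_def intro!: loc)
  have ml: "multilinear g"
    unfolding multilinear_def
  proof (intro allI)
    fix us vs
    show "Vector_Spaces.linear scale scale (\<lambda>v. g (us @ v # vs))"
    proof (cases "Suc (length us + length vs) = n")
      case True
      have "g (us @ v # vs) = f ((nth (us @ 0 # vs))(length us := v))" for v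
        using True by (auto simp: g_def nth_append nth_Cons' intro!: loc)
      thus ?thesis using lin[of "length us"] True by simp
    qed (simp add: g_def linear_0)
  qed
  have "g (us @ a # a # vs) = 0" for us a vs
  proof (cases "length (us @ a # a # vs) = n")
    case True
    hence "f (nth (us @ a # a # vs)) = 0"
      by (intro alt[of "length us" "Suc (length us)"]) (simp_all add: nth_append)
    thus ?thesis by (simp add: g_def)
  qed (simp add: g_def)
  hence "skew g" by (rule skew_if_vanishing[OF ml])
  moreover have "g (map \<alpha> xs) = \<alpha> (g xs)" for xs
    using linear_map_0[OF linear_alpha] by (auto simp: g_def eqv intro!: loc)
  ultimately show "g \<in> list_cochains n"
    using ml by (simp add: list_cochains_def g_def)
qed

lemma linear_alpha_pow: "Vector_Spaces.linear scale scale (\<alpha> ^^ k)"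
proof (induction k)
  case 0
  show ?case by unfold_locales simp_all
next
  case (Suc k)
  show ?case unfolding funpow.simps by (rule Vector_Spaces.linear_compose[OF Suc linear_alpha])
qed

lemma alpha_pow_add: "(\<alpha> ^^ a) ((\<alpha> ^^ b) x) = (\<alpha> ^^ (a + b)) x"
  by (simp add: funpow_add)

lemma map_alpha_pow: "map (\<alpha> ^^ a) (map (\<alpha> ^^ b) xs) = map (\<alpha> ^^ (a + b)) xs"
  by (simp add: funpow_add)

lemma alpha_pow_bracket: "(\<alpha> ^^ k) [x, y]\<^sub>\<g> = [(\<alpha> ^^ k) x, (\<alpha> ^^ k) y]\<^sub>\<g>"
  by (induction k) (simp_all add: multiplicative)

lemma list_cochain_alpha_pow:
  assumes "f \<in> list_cochains n"
  shows "f (map (\<alpha> ^^ k) xs) = (\<alpha> ^^ k) (f xs)"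
proof (induction k)
  case (Suc k)
  have "f (map (\<alpha> ^^ Suc k) xs) = f (map \<alpha> (map (\<alpha> ^^ k) xs))" by simp
  also have "\<dots> = (\<alpha> ^^ Suc k) (f xs)" by (simp only: list_cochainsD(4)[OF assms] Suc funpow.simps o_apply)
  finally show ?case .
qed simp

lemma alpha_pow_0 [simp]: "(\<alpha> ^^ k) 0 = 0"
  using linear_map_0[OF linear_alpha_pow] .

lemma bracket_0 [simp]: "[0, y]\<^sub>\<g> = 0" "[x, 0]\<^sub>\<g> = 0"
  using linear_map_0[OF linear_bracket_left] linear_map_0[OF linear_bracket_right] .

lemma list_cochain_Cons_0: "f \<in> list_cochains n \<Longrightarrow> f (0 # xs) = 0"
  using linear_map_0[OF multilinearD[OF list_cochainsD(2)], of f n "[]"] by simp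

lemma linear_list_cochain_Cons:
  "f \<in> list_cochains n \<Longrightarrow> Vector_Spaces.linear scale scale (\<lambda>v. f (v # xs))"
  using multilinearD[OF list_cochainsD(2), of f n "[]" xs] by simp

text \<open>
  The exponents of \<open>\<alpha>\<close> are read off from the lengths of the subsequences. The truncated
  \<open>length ys - 1\<close> for \<open>ys = []\<close> does no harm: an argument of positive degree vanishes on \<open>[]\<close>.
\<close>

definition list_ins :: "('v list \<Rightarrow> 'v) \<Rightarrow> ('v list \<Rightarrow> 'v) \<Rightarrow> 'v list \<Rightarrow> 'v"
  where "list_ins P Q xs =
    unshuffle xs (\<lambda>ys zs. Q (P ys # map (\<alpha> ^^ (length ys - 1)) zs))"

definition list_cup :: "('v list \<Rightarrow> 'v) \<Rightarrow> ('v list \<Rightarrow> 'v) \<Rightarrow> 'v list \<Rightarrow> 'v"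
  where "list_cup P Q xs =
    unshuffle xs (\<lambda>ys zs. [(\<alpha> ^^ (length zs - 1)) (P ys), (\<alpha> ^^ (length ys - 1)) (Q zs)]\<^sub>\<g>)"

lemma list_ins_closed:
  assumes P: "P \<in> list_cochains (Suc m)" and Q: "Q \<in> list_cochains n" and n: "n \<ge> 1"
  shows "list_ins P Q \<in> list_cochains (m + n)"
proof -
  have len: "list_ins P Q xs = 0" if "length xs \<noteq> m + n" for xs
  proof -
    have "list_ins P Q xs = unshuffle xs (\<lambda>ys zs. 0)"
      unfolding list_ins_def
    proof (rule unshuffle_cong)
      fix ys zs :: "'v list" assume "length ys + length zs = length xs"
      thus "Q (P ys # map (\<alpha> ^^ (length ys - 1)) zs) = 0"
        using that list_cochainsD(1)[OF P, of ys] list_cochain_Cons_0[OF Q]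
          list_cochainsD(1)[OF Q, of "P ys # map (\<alpha> ^^ (length ys - 1)) zs"]
        by (cases "length ys = Suc m") simp_all
    qed
    thus ?thesis by (simp add: unshuffle_0)
  qed
  have "multilinear (\<lambda>xs. list_ins P Q xs)"
    unfolding list_ins_def
  proof (rule multilinear_unshuffle)
    show "multilinear (\<lambda>ys. Q (P ys # map (\<alpha> ^^ (length ys - 1)) zs))" for zs
      unfolding multilinear_def length_append length_Cons
      by (intro allI linear_comp[OF multilinearD[OF list_cochainsD(2)[OF P]] linear_list_cochain_Cons[OF Q]])
    show "multilinear (\<lambda>zs. Q (P ys # map (\<alpha> ^^ (length ys - 1)) zs))" for ys
      unfolding multilinear_def
    proof (intro allI)
      fix us vs
      let ?a = "\<alpha> ^^ (length ys - 1)"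
      show "Vector_Spaces.linear scale scale (\<lambda>v. Q (P ys # map ?a (us @ v # vs)))"
        using linear_comp[OF linear_alpha_pow multilinearD[OF list_cochainsD(2)[OF Q],
              where us = "P ys # map ?a us" and vs = "map ?a vs"]] by simp
    qed
  qed
  moreover have "skew (\<lambda>xs. list_ins P Q xs)"
    unfolding list_ins_def
  proof (rule skew_unshuffle)
    show "skew (\<lambda>ys. Q (P ys # map (\<alpha> ^^ (length ys - 1)) zs))" for zs
      unfolding skew_def
    proof (intro allI)
      fix us a b vs
      have "P (us @ a # b # vs) = - P (us @ b # a # vs)" by (rule skewD[OF list_cochainsD(3)[OF P]])
      thus "Q (P (us @ a # b # vs) # map (\<alpha> ^^ (length (us @ a # b # vs) - 1)) zs) =
       - Q (P (us @ b # a # vs) # map (\<alpha> ^^ (length (us @ b # a # vs) - 1)) zs)"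
        using linear_map_neg[OF linear_list_cochain_Cons[OF Q]] by simp
    qed
    show "skew (\<lambda>zs. Q (P ys # map (\<alpha> ^^ (length ys - 1)) zs))" for ys
      unfolding skew_def
    proof (intro allI)
      fix us a b vs
      let ?a = "\<alpha> ^^ (length ys - 1)"
      show "Q (P ys # map ?a (us @ a # b # vs)) = - Q (P ys # map ?a (us @ b # a # vs))"
        using skewD[OF list_cochainsD(3)[OF Q], where us = "P ys # map ?a us" and vs = "map ?a vs",
            of "?a a" "?a b"] unfolding append_Cons list.map map_append .
    qed
  qed
  moreover have "list_ins P Q (map \<alpha> xs) = \<alpha> (list_ins P Q xs)" for xs
    unfolding list_ins_def unshuffle_map unshuffle_linear[OF linear_alpha]
  proof (rule unshuffle_cong)
    fix ys zs
    have "P (map \<alpha> ys) # map (\<alpha> ^^ (length (map \<alpha> ys) - 1)) (map \<alpha> zs) =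
       map \<alpha> (P ys # map (\<alpha> ^^ (length ys - 1)) zs)"
      using list_cochainsD(4)[OF P] by (simp add: funpow_swap1)
    thus "Q (P (map \<alpha> ys) # map (\<alpha> ^^ (length (map \<alpha> ys) - 1)) (map \<alpha> zs)) =
      \<alpha> (Q (P ys # map (\<alpha> ^^ (length ys - 1)) zs))"
      by (simp only: list_cochainsD(4)[OF Q])
  qed
  ultimately show ?thesis using len by (simp add: list_cochains_def)
qed

lemma list_cup_closed:
  assumes P: "P \<in> list_cochains m" and Q: "Q \<in> list_cochains n"
  shows "list_cup P Q \<in> list_cochains (m + n)"
proof -
  have len: "list_cup P Q xs = 0" if "length xs \<noteq> m + n" for xs
  proof -
    have "list_cup P Q xs = unshuffle xs (\<lambda>ys zs. 0)"
      unfolding list_cup_def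
    proof (rule unshuffle_cong)
      fix ys zs :: "'v list" assume "length ys + length zs = length xs"
      thus "[(\<alpha> ^^ (length zs - 1)) (P ys), (\<alpha> ^^ (length ys - 1)) (Q zs)]\<^sub>\<g> = 0"
        using that list_cochainsD(1)[OF P, of ys] list_cochainsD(1)[OF Q, of zs]
        by (cases "length ys = m") simp_all
    qed
    thus ?thesis by (simp add: unshuffle_0)
  qed
  have "multilinear (\<lambda>xs. list_cup P Q xs)"
    unfolding list_cup_def
  proof (rule multilinear_unshuffle)
    show "multilinear (\<lambda>ys. [(\<alpha> ^^ (length zs - 1)) (P ys), (\<alpha> ^^ (length ys - 1)) (Q zs)]\<^sub>\<g>)" for zs
      unfolding multilinear_def length_append length_Cons
      by (intro allI linear_comp[OF linear_comp[OF multilinearD[OF list_cochainsD(2)[OF P]]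
            linear_alpha_pow] linear_bracket_left])
    show "multilinear (\<lambda>zs. [(\<alpha> ^^ (length zs - 1)) (P ys), (\<alpha> ^^ (length ys - 1)) (Q zs)]\<^sub>\<g>)" for ys
      unfolding multilinear_def length_append length_Cons
      by (intro allI linear_comp[OF linear_comp[OF multilinearD[OF list_cochainsD(2)[OF Q]]
            linear_alpha_pow] linear_bracket_right])
  qed
  moreover have "skew (\<lambda>xs. list_cup P Q xs)"
    unfolding list_cup_def
  proof (rule skew_unshuffle)
    show "skew (\<lambda>ys. [(\<alpha> ^^ (length zs - 1)) (P ys), (\<alpha> ^^ (length ys - 1)) (Q zs)]\<^sub>\<g>)" for zs
      unfolding skew_def
    proof (intro allI)
      fix us a b vs
      have "P (us @ a # b # vs) = - P (us @ b # a # vs)" by (rule skewD[OF list_cochainsD(3)[OF P]])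
      thus "[(\<alpha> ^^ (length zs - 1)) (P (us @ a # b # vs)), (\<alpha> ^^ (length (us @ a # b # vs) - 1)) (Q zs)]\<^sub>\<g>
        = - [(\<alpha> ^^ (length zs - 1)) (P (us @ b # a # vs)), (\<alpha> ^^ (length (us @ b # a # vs) - 1)) (Q zs)]\<^sub>\<g>"
        using linear_map_neg[OF linear_bracket_left] linear_map_neg[OF linear_alpha_pow] by simp
    qed
    show "skew (\<lambda>zs. [(\<alpha> ^^ (length zs - 1)) (P ys), (\<alpha> ^^ (length ys - 1)) (Q zs)]\<^sub>\<g>)" for ys
      unfolding skew_def
    proof (intro allI)
      fix us a b vs
      have "Q (us @ a # b # vs) = - Q (us @ b # a # vs)" by (rule skewD[OF list_cochainsD(3)[OF Q]])
      thus "[(\<alpha> ^^ (length (us @ a # b # vs) - 1)) (P ys), (\<alpha> ^^ (length ys - 1)) (Q (us @ a # b # vs))]\<^sub>\<g>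
        = - [(\<alpha> ^^ (length (us @ b # a # vs) - 1)) (P ys), (\<alpha> ^^ (length ys - 1)) (Q (us @ b # a # vs))]\<^sub>\<g>"
        using linear_map_neg[OF linear_bracket_right] linear_map_neg[OF linear_alpha_pow] by simp
    qed
  qed
  moreover have "list_cup P Q (map \<alpha> xs) = \<alpha> (list_cup P Q xs)" for xs
    unfolding list_cup_def unshuffle_map unshuffle_linear[OF linear_alpha]
    by (rule unshuffle_cong)
      (simp add: list_cochainsD(4)[OF P] list_cochainsD(4)[OF Q] multiplicative funpow_swap1)
  ultimately show ?thesis using len by (simp add: list_cochains_def)
qed

text \<open>
  The right-hand side contains splittings of all lengths, but those other than \<open>Suc m\<close> and \<open>n - 1\<close>
  contribute 0.
\<close>

lemma insertion_from_list:
  assumes P: "P \<in> list_cochains (Suc m)" and Q: "Q \<in> list_cochains n" and n: "n \<ge> 1"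
  shows "insertion (Suc m) n (from_list (Suc m) P) (from_list n Q) = from_list (m + n) (list_ins P Q)"
proof
  fix x
  obtain k where k: "n = Suc k" using n by (cases n) auto
  let ?F = "\<lambda>ys zs. Q (P ys # map (\<alpha> ^^ m) zs)"
  have "insertion (Suc m) n (from_list (Suc m) P) (from_list n Q) x =
    (\<Sum>\<sigma>\<in>shuffles_perm (Suc m) k. of_int (sign \<sigma>) *s
      ?F (map (\<lambda>i. x (\<sigma> i)) [0..<Suc m]) (map (\<lambda>i. x (\<sigma> i)) [Suc m..<Suc m + k]))"
    unfolding insertion_def
  proof (intro sum.cong)
    fix \<sigma>
    have 1: "map (case_nat v y) [0..<n] = v # map y [0..<k]" for v :: 'v and y
      by (simp add: k upt_conv_Cons map_Suc_upt[symmetric] o_def del: upt_Suc)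
    have 2: "map (\<lambda>i. x (\<sigma> i)) [Suc m..<Suc m + k] = map (\<lambda>i. x (\<sigma> (Suc m + i))) [0..<k]"
      by (rule nth_equalityI) (simp_all del: upt_Suc)
    show "of_int (sign \<sigma>) *s from_list n Q (case_nat (from_list (Suc m) P (\<lambda>i. x (\<sigma> i)))
        (\<lambda>i. (\<alpha> ^^ (Suc m - 1)) (x (\<sigma> (Suc m + i))))) = of_int (sign \<sigma>) *s
      ?F (map (\<lambda>i. x (\<sigma> i)) [0..<Suc m]) (map (\<lambda>i. x (\<sigma> i)) [Suc m..<Suc m + k])"
      unfolding from_list_def 1 2 by (simp add: o_def)
  qed (simp add: k)
  also have "\<dots> = unshuffle (map x [0..<Suc m + k])
     (\<lambda>ys zs. if length ys = Suc m \<and> length zs = k then ?F ys zs else 0)"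
    by (rule unshuffle_eq_sum_shuffles)
  also have "\<dots> = from_list (m + n) (list_ins P Q) x"
    unfolding from_list_def list_ins_def k add_Suc_right add_Suc
  proof (rule unshuffle_cong)
    fix ys zs :: "'v list" assume "length ys + length zs = length (map x [0..<Suc (m + k)])"
    thus "(if length ys = Suc m \<and> length zs = k then ?F ys zs else 0) =
       Q (P ys # map (\<alpha> ^^ (length ys - 1)) zs)"
      using list_cochainsD(1)[OF P, of ys] list_cochain_Cons_0[OF Q]
      by (cases "length ys = Suc m") simp_all
  qed
  finally show "insertion (Suc m) n (from_list (Suc m) P) (from_list n Q) x = from_list (m + n) (list_ins P Q) x" .
qed

lemma cup_bracket_from_list:
  assumes P: "P \<in> list_cochains m" and Q: "Q \<in> list_cochains n"
  shows "cup_bracket m n (from_list m P) (from_list n Q) = from_list (m + n) (list_cup P Q)"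
proof
  fix x
  let ?F = "\<lambda>ys zs. [(\<alpha> ^^ (n - 1)) (P ys), (\<alpha> ^^ (m - 1)) (Q zs)]\<^sub>\<g>"
  have "cup_bracket m n (from_list m P) (from_list n Q) x =
    (\<Sum>\<sigma>\<in>shuffles_perm m n. of_int (sign \<sigma>) *s
      ?F (map (\<lambda>i. x (\<sigma> i)) [0..<m]) (map (\<lambda>i. x (\<sigma> i)) [m..<m + n]))"
    unfolding cup_bracket_def
  proof (intro sum.cong refl)
    fix \<sigma>
    have 2: "map (\<lambda>i. x (\<sigma> i)) [m..<m + n] = map (\<lambda>i. x (\<sigma> (m + i))) [0..<n]"
      by (rule nth_equalityI) simp_all
    show "of_int (sign \<sigma>) *s [(\<alpha> ^^ (n - 1)) (from_list m P (\<lambda>i. x (\<sigma> i))),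
        (\<alpha> ^^ (m - 1)) (from_list n Q (\<lambda>i. x (\<sigma> (m + i))))]\<^sub>\<g> = of_int (sign \<sigma>) *s
      ?F (map (\<lambda>i. x (\<sigma> i)) [0..<m]) (map (\<lambda>i. x (\<sigma> i)) [m..<m + n])"
      unfolding from_list_def 2 ..
  qed
  also have "\<dots> = unshuffle (map x [0..<m + n])
     (\<lambda>ys zs. if length ys = m \<and> length zs = n then ?F ys zs else 0)"
    by (rule unshuffle_eq_sum_shuffles)
  also have "\<dots> = from_list (m + n) (list_cup P Q) x"
    unfolding from_list_def list_cup_def
  proof (rule unshuffle_cong)
    fix ys zs :: "'v list"
    show "(if length ys = m \<and> length zs = n then ?F ys zs else 0) =
       [(\<alpha> ^^ (length zs - 1)) (P ys), (\<alpha> ^^ (length ys - 1)) (Q zs)]\<^sub>\<g>"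
      using list_cochainsD(1)[OF P, of ys] list_cochainsD(1)[OF Q, of zs]
      by (cases "length ys = m") simp_all
  qed
  finally show "cup_bracket m n (from_list m P) (from_list n Q) x = from_list (m + n) (list_cup P Q) x" .
qed

end

section \<open>Identities for insertion and cup bracket\<close>

context hom_lie_algebra
begin

lemma bracket_neg: "[- x, y]\<^sub>\<g> = - [x, y]\<^sub>\<g>" "[x, - y]\<^sub>\<g> = - [x, y]\<^sub>\<g>"
  by (rule linear_map_neg[OF linear_bracket_left] linear_map_neg[OF linear_bracket_right])+

text \<open>
  The terms of \<open>i\<^sub>P (i\<^sub>Q R)\<close> in which \<open>P\<close> and \<open>Q\<close> occupy two different arguments of \<open>R\<close>. The sign
  \<open>(-1) ^ length as\<close> comes from moving the value of \<open>P\<close> behind the arguments \<open>as\<close> of \<open>Q\<close>.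
\<close>

definition list_associator :: "('v list \<Rightarrow> 'v) \<Rightarrow> ('v list \<Rightarrow> 'v) \<Rightarrow> ('v list \<Rightarrow> 'v) \<Rightarrow> 'v list \<Rightarrow> 'v"
  where "list_associator P Q R xs = unshuffle xs (\<lambda>ys r. unshuffle r (\<lambda>as bs.
    (-1) ^ length as *s R ((\<alpha> ^^ (length ys - 1)) (Q as) # (\<alpha> ^^ (length as - 1)) (P ys) #
       map (\<alpha> ^^ (length as - 1 + (length ys - 1))) bs)))"

text \<open>
  In \<open>i\<^sub>P (i\<^sub>Q R)\<close> the value of \<open>P\<close> is the first entry of the list that is split for \<open>Q\<close>, so one step
  of the recursion for \<^const>\<open>unshuffle\<close> separates the terms where it is an argument of \<open>Q\<close> from those
  where it stays an argument of \<open>R\<close>. The former are \<open>i\<^bsub>i\<^sub>P Q\<^esub> R\<close> by coassociativity.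
\<close>

lemma list_ins_associator:
  assumes P: "P \<in> list_cochains (Suc m)" and Q: "Q \<in> list_cochains n" and R: "R \<in> list_cochains k"
  shows "list_ins P (list_ins Q R) xs = list_ins (list_ins P Q) R xs + list_associator P Q R xs"
proof -
  have L: "list_ins P (list_ins Q R) xs = unshuffle xs (\<lambda>ys r. unshuffle r (\<lambda>as bs.
      R (Q (P ys # map (\<alpha> ^^ (length ys - 1)) as) # map (\<alpha> ^^ (length as + (length ys - 1))) bs))) +
      list_associator P Q R xs"
    unfolding list_ins_def list_associator_def unshuffle_add[symmetric] unshuffle.simps unshuffle_map
    by (simp only: list_cochain_alpha_pow[OF Q] map_alpha_pow list.map length_map length_Cons diff_Suc_1)
  have M: "list_ins (list_ins P Q) R xs = unshuffle xs (\<lambda>u bs. unshuffle u (\<lambda>ys as.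
      R (Q (P ys # map (\<alpha> ^^ (length ys - 1)) as) # map (\<alpha> ^^ (length as + (length ys - 1))) bs)))"
    unfolding list_ins_def unshuffle_linear[OF linear_list_cochain_Cons[OF R]]
  proof (intro unshuffle_cong)
    fix u bs ys as :: "'v list" assume "length ys + length as = length u"
    hence "length ys = Suc m \<Longrightarrow> length u - 1 = length as + (length ys - 1)" by simp
    thus "R (Q (P ys # map (\<alpha> ^^ (length ys - 1)) as) # map (\<alpha> ^^ (length u - 1)) bs) =
      R (Q (P ys # map (\<alpha> ^^ (length ys - 1)) as) # map (\<alpha> ^^ (length as + (length ys - 1))) bs)"
      using list_cochainsD(1)[OF P, of ys] list_cochain_Cons_0[OF Q] list_cochain_Cons_0[OF R]
      by (cases "length ys = Suc m") simp_all
  qed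
  show ?thesis unfolding L M unshuffle_coassoc ..
qed

text \<open>
  Exchanging the argument lists of \<open>P\<close> and \<open>Q\<close> by cocommutativity and their values by skewness of
  \<open>R\<close> changes the sign by the exponent \<open>(m + 1) (n + 1) + (m + 1) + (n + 1) + 1\<close>, which has the
  parity of \<open>m n\<close>.
\<close>

lemma list_associator_symmetric:
  assumes P: "P \<in> list_cochains (Suc m)" and Q: "Q \<in> list_cochains (Suc n)" and R: "R \<in> list_cochains k"
  shows "list_associator P Q R xs = (-1) ^ (m * n) *s list_associator Q P R xs"
  unfolding list_associator_def
  apply (subst unshuffle_swap12)
  unfolding unshuffle_scale[symmetric]
proof (intro unshuffle_cong)
  fix ys r as bs :: "'v list"
  have sk: "R (x # y # zs) = - R (y # x # zs)" for x y zs
    using skewD[OF list_cochainsD(3)[OF R], where us = "[]"] unfolding append_Nil .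
  show "(- 1) ^ (length ys * length as) *s (- 1) ^ length ys *s
      R ((\<alpha> ^^ (length as - 1)) (Q ys) # (\<alpha> ^^ (length ys - 1)) (P as) #
         map (\<alpha> ^^ (length ys - 1 + (length as - 1))) bs) =
    (- 1) ^ (m * n) *s (- 1) ^ length as *s
      R ((\<alpha> ^^ (length ys - 1)) (P as) # (\<alpha> ^^ (length as - 1)) (Q ys) #
         map (\<alpha> ^^ (length as - 1 + (length ys - 1))) bs)" (is "?l *s ?s *s R (?x # ?y # _) = _")
  proof (cases "length as = Suc m \<and> length ys = Suc n")
    case True
    thus ?thesis using sk[of ?x ?y]
      by (cases "even m"; cases "even n") (simp_all add: add.commute)
  next
    case False
    hence "P as = 0 \<or> Q ys = 0" using list_cochainsD(1)[OF P] list_cochainsD(1)[OF Q] by blast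
    thus ?thesis using sk[of ?x ?y] by (auto simp: list_cochain_Cons_0[OF R] sk[of _ 0])
  qed
qed

lemma list_ins_pre_lie:
  assumes P: "P \<in> list_cochains (Suc m)" and Q: "Q \<in> list_cochains (Suc n)" and R: "R \<in> list_cochains k"
  shows "list_ins P (list_ins Q R) xs - list_ins (list_ins P Q) R xs =
    (-1) ^ (m * n) *s (list_ins Q (list_ins P R) xs - list_ins (list_ins Q P) R xs)"
  using list_ins_associator[OF P Q R, of xs] list_ins_associator[OF Q P R, of xs]
    list_associator_symmetric[OF P Q R, of xs] by simp

text \<open>
  One step of the recursion for \<^const>\<open>unshuffle\<close> decides whether the value of \<open>P\<close> becomes an argument
  of \<open>Q\<close> (terms \<open>?G\<close>) or of \<open>R\<close> (terms \<open>?H\<close>). In the latter case the arguments of \<open>P\<close> have to be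
  moved past those of \<open>Q\<close>.
\<close>

lemma list_ins_derivation:
  assumes P: "P \<in> list_cochains (Suc m)" and Q: "Q \<in> list_cochains n" and R: "R \<in> list_cochains k"
  shows "list_ins P (list_cup Q R) xs =
    list_cup (list_ins P Q) R xs + (-1) ^ (m * n) *s list_cup Q (list_ins P R) xs"
proof -
  let ?G = "\<lambda>ys as bs. [(\<alpha> ^^ (length bs - 1)) (Q (P ys # map (\<alpha> ^^ (length ys - 1)) as)),
       (\<alpha> ^^ (length as + (length ys - 1))) (R bs)]\<^sub>\<g>"
  let ?H = "\<lambda>ys as bs. [(\<alpha> ^^ (length bs + (length ys - 1))) (Q as),
       (\<alpha> ^^ (length as - 1)) (R (P ys # map (\<alpha> ^^ (length ys - 1)) bs))]\<^sub>\<g>"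
  have L: "list_ins P (list_cup Q R) xs = unshuffle xs (\<lambda>ys r. unshuffle r (?G ys)) +
     unshuffle xs (\<lambda>ys r. unshuffle r (\<lambda>as bs. (-1) ^ length as *s ?H ys as bs))"
    unfolding list_ins_def list_cup_def unshuffle_add[symmetric] unshuffle.simps unshuffle_map
    by (simp only: list_cochain_alpha_pow[OF Q] list_cochain_alpha_pow[OF R] alpha_pow_add
         list.map length_map length_Cons diff_Suc_1)
  have M: "list_cup (list_ins P Q) R xs = unshuffle xs (\<lambda>u bs. unshuffle u (\<lambda>ys as. ?G ys as bs))"
    unfolding list_ins_def list_cup_def
      unshuffle_linear[OF linear_comp[OF linear_alpha_pow linear_bracket_left]]
  proof (intro unshuffle_cong)
    fix u bs ys as :: "'v list" assume "length ys + length as = length u"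
    hence "length ys = Suc m \<Longrightarrow> length u - 1 = length as + (length ys - 1)" by simp
    thus "[(\<alpha> ^^ (length bs - 1)) (Q (P ys # map (\<alpha> ^^ (length ys - 1)) as)), (\<alpha> ^^ (length u - 1)) (R bs)]\<^sub>\<g> = ?G ys as bs"
      using list_cochainsD(1)[OF P, of ys] list_cochain_Cons_0[OF Q]
      by (cases "length ys = Suc m") simp_all
  qed
  have N: "(-1) ^ (m * n) *s list_cup Q (list_ins P R) xs =
     unshuffle xs (\<lambda>ys r. unshuffle r (\<lambda>as bs. (-1) ^ length as *s ?H ys as bs))"
    unfolding list_ins_def list_cup_def
      unshuffle_linear[OF linear_comp[OF linear_alpha_pow linear_bracket_right]]
    apply (subst unshuffle_swap12[of xs "\<lambda>ys as bs. (-1) ^ length as *s ?H ys as bs"])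
    unfolding unshuffle_scale[symmetric]
  proof (intro unshuffle_cong)
    fix as r ys bs :: "'v list" assume "length ys + length bs = length r"
    hence "length ys = Suc m \<Longrightarrow> length r - 1 = length bs + (length ys - 1)" by simp
    thus "(- 1) ^ (m * n) *s [(\<alpha> ^^ (length r - 1)) (Q as), (\<alpha> ^^ (length as - 1)) (R (P ys # map (\<alpha> ^^ (length ys - 1)) bs))]\<^sub>\<g> =
       (- 1) ^ (length as * length ys) *s (- 1) ^ length as *s ?H ys as bs"
      using list_cochainsD(1)[OF P, of ys] list_cochainsD(1)[OF Q, of as] list_cochain_Cons_0[OF R]
      by (cases "length ys = Suc m"; cases "length as = n"; cases "even n"; cases "even m") auto
  qed
  show ?thesis unfolding L M N unshuffle_coassoc ..
qed

lemma list_cup_skew: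
  assumes P: "P \<in> list_cochains m" and Q: "Q \<in> list_cochains n"
  shows "list_cup P Q xs = - ((-1) ^ (m * n) *s list_cup Q P xs)"
  unfolding list_cup_def
  apply (subst unshuffle_cocomm)
  unfolding unshuffle_scale[symmetric] unshuffle_minus[symmetric]
proof (rule unshuffle_cong)
  fix ys zs :: "'v list"
  show "(- 1) ^ (length ys * length zs) *s [(\<alpha> ^^ (length ys - 1)) (P zs), (\<alpha> ^^ (length zs - 1)) (Q ys)]\<^sub>\<g>
    = - ((- 1) ^ (m * n) *s [(\<alpha> ^^ (length zs - 1)) (Q ys), (\<alpha> ^^ (length ys - 1)) (P zs)]\<^sub>\<g>)"
    using list_cochainsD(1)[OF P, of zs] list_cochainsD(1)[OF Q, of ys]
      bracket_skew[of "(\<alpha> ^^ (length ys - 1)) (P zs)"]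
    by (cases "length zs = m"; cases "length ys = n") (auto simp: mult.commute)
qed

lemma hom_jacobi_derivation:
  "[\<alpha> x, [y, z]\<^sub>\<g>]\<^sub>\<g> = [[x, y]\<^sub>\<g>, \<alpha> z]\<^sub>\<g> + [\<alpha> y, [x, z]\<^sub>\<g>]\<^sub>\<g>"
proof -
  have "[\<alpha> y, [z, x]\<^sub>\<g>]\<^sub>\<g> = - [\<alpha> y, [x, z]\<^sub>\<g>]\<^sub>\<g>"
    using bracket_skew[of z x] bracket_neg(2) by simp
  moreover have "[\<alpha> z, [x, y]\<^sub>\<g>]\<^sub>\<g> = - [[x, y]\<^sub>\<g>, \<alpha> z]\<^sub>\<g>" by (rule bracket_skew)
  ultimately show ?thesis using hom_jacobi[of x y z] by (simp add: algebra_simps)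
qed

text \<open>
  After the arguments are brought to the same order, the identity holds summand by summand: it is the
  Hom-Jacobi identity for \<open>\<alpha>\<^bsup>n+k-2\<^esup> P\<close>, \<open>\<alpha>\<^bsup>m+k-2\<^esup> Q\<close> and \<open>\<alpha>\<^bsup>m+n-2\<^esup> R\<close>, where the
  outer entry of each double bracket carries one more \<open>\<alpha>\<close>.
\<close>

lemma list_cup_jacobi:
  assumes mnk: "m \<ge> 1" "n \<ge> 1" "k \<ge> 1"
    and P: "P \<in> list_cochains m" and Q: "Q \<in> list_cochains n" and R: "R \<in> list_cochains k"
  shows "list_cup P (list_cup Q R) xs =
    list_cup (list_cup P Q) R xs + (-1) ^ (m * n) *s list_cup Q (list_cup P R) xs"
proof -
  have L: "list_cup P (list_cup Q R) xs = unshuffle xs (\<lambda>as r. unshuffle r (\<lambda>bs cs.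
    [(\<alpha> ^^ (n + k - 1)) (P as), [(\<alpha> ^^ (m + k - 2)) (Q bs), (\<alpha> ^^ (m + n - 2)) (R cs)]\<^sub>\<g>]\<^sub>\<g>))"
    if "m \<ge> 1" "n \<ge> 1" "k \<ge> 1" "P \<in> list_cochains m" "Q \<in> list_cochains n" "R \<in> list_cochains k"
    for P Q R m n k
    unfolding list_cup_def unshuffle_linear[OF linear_comp[OF linear_alpha_pow linear_bracket_right]]
  proof (intro unshuffle_cong)
    fix as r bs cs :: "'v list" assume "length bs + length cs = length r"
    hence len: "length as = m \<Longrightarrow> length bs = n \<Longrightarrow> length cs = k \<Longrightarrow> length r = n + k" by simp
    have e: "m - 1 + (k - 1) = m + k - 2" "m - 1 + (n - 1) = m + n - 2" using that(1-3) by simp_all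
    show "[(\<alpha> ^^ (length r - 1)) (P as), (\<alpha> ^^ (length as - 1)) [(\<alpha> ^^ (length cs - 1)) (Q bs), (\<alpha> ^^ (length bs - 1)) (R cs)]\<^sub>\<g>]\<^sub>\<g> =
      [(\<alpha> ^^ (n + k - 1)) (P as), [(\<alpha> ^^ (m + k - 2)) (Q bs), (\<alpha> ^^ (m + n - 2)) (R cs)]\<^sub>\<g>]\<^sub>\<g>"
    proof (cases "length as = m \<and> length bs = n \<and> length cs = k")
      case True
      thus ?thesis by (simp only: len alpha_pow_bracket alpha_pow_add e)
    next
      case False
      hence "P as = 0 \<or> Q bs = 0 \<or> R cs = 0" using that(4-6) list_cochainsD(1) by blast
      thus ?thesis by (elim disjE) simp_all
    qed
  qed
  have M: "list_cup (list_cup P Q) R xs = unshuffle xs (\<lambda>u cs. unshuffle u (\<lambda>as bs.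
    [[(\<alpha> ^^ (n + k - 2)) (P as), (\<alpha> ^^ (m + k - 2)) (Q bs)]\<^sub>\<g>, (\<alpha> ^^ (m + n - 1)) (R cs)]\<^sub>\<g>))"
    unfolding list_cup_def unshuffle_linear[OF linear_comp[OF linear_alpha_pow linear_bracket_left]]
  proof (intro unshuffle_cong)
    fix u as bs cs :: "'v list" assume "length as + length bs = length u"
    hence len: "length as = m \<Longrightarrow> length bs = n \<Longrightarrow> length cs = k \<Longrightarrow> length u = m + n" by simp
    have e: "k - 1 + (n - 1) = n + k - 2" "k - 1 + (m - 1) = m + k - 2" using mnk by simp_all
    show "[(\<alpha> ^^ (length cs - 1)) [(\<alpha> ^^ (length bs - 1)) (P as), (\<alpha> ^^ (length as - 1)) (Q bs)]\<^sub>\<g>, (\<alpha> ^^ (length u - 1)) (R cs)]\<^sub>\<g> =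
      [[(\<alpha> ^^ (n + k - 2)) (P as), (\<alpha> ^^ (m + k - 2)) (Q bs)]\<^sub>\<g>, (\<alpha> ^^ (m + n - 1)) (R cs)]\<^sub>\<g>"
    proof (cases "length as = m \<and> length bs = n \<and> length cs = k")
      case True
      thus ?thesis by (simp only: len alpha_pow_bracket alpha_pow_add e)
    next
      case False
      hence "P as = 0 \<or> Q bs = 0 \<or> R cs = 0" using P Q R list_cochainsD(1) by blast
      thus ?thesis by (elim disjE) simp_all
    qed
  qed
  have N: "(-1) ^ (m * n) *s list_cup Q (list_cup P R) xs = unshuffle xs (\<lambda>as r. unshuffle r (\<lambda>bs cs.
    [(\<alpha> ^^ (m + k - 1)) (Q bs), [(\<alpha> ^^ (n + k - 2)) (P as), (\<alpha> ^^ (m + n - 2)) (R cs)]\<^sub>\<g>]\<^sub>\<g>))"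
    unfolding L[OF mnk(2,1,3) Q P R]
    apply (subst unshuffle_swap12)
    unfolding unshuffle_scale[symmetric]
  proof (intro unshuffle_cong)
    fix as r bs cs :: "'v list"
    show "(- 1) ^ (m * n) *s (- 1) ^ (length as * length bs) *s
       [(\<alpha> ^^ (m + k - 1)) (Q bs), [(\<alpha> ^^ (n + k - 2)) (P as), (\<alpha> ^^ (n + m - 2)) (R cs)]\<^sub>\<g>]\<^sub>\<g> =
      [(\<alpha> ^^ (m + k - 1)) (Q bs), [(\<alpha> ^^ (n + k - 2)) (P as), (\<alpha> ^^ (m + n - 2)) (R cs)]\<^sub>\<g>]\<^sub>\<g>"
      using list_cochainsD(1)[OF P, of as] list_cochainsD(1)[OF Q, of bs]
      by (cases "length as = m"; cases "length bs = n"; cases "even m"; cases "even n") (auto simp: add.commute)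
  qed
  have e: "n + k - 1 = Suc (n + k - 2)" "m + k - 1 = Suc (m + k - 2)" "m + n - 1 = Suc (m + n - 2)"
    using mnk by simp_all
  show ?thesis
    unfolding L[OF mnk P Q R] M N unshuffle_coassoc unshuffle_add[symmetric]
    unfolding e funpow.simps o_apply by (intro unshuffle_cong hom_jacobi_derivation)
qed

end

section \<open>The derived bracket\<close>

context hom_lie_algebra
begin

text \<open>
  The element \<open>e\<close> of \<^locale>\<open>insertion_lie_algebra\<close>.
\<close>

definition list_id :: "'v list \<Rightarrow> 'v"
  where "list_id xs = (if length xs = 1 then hd xs else 0)"

lemma list_id_closed: "list_id \<in> list_cochains 1"
proof -
  have "Vector_Spaces.linear scale scale (\<lambda>v. list_id (us @ v # vs))" for us vs
    by (cases "us = [] \<and> vs = []")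
      (unfold_locales, auto simp: list_id_def)
  moreover have "list_id (us @ a # b # vs) = - list_id (us @ b # a # vs)" for us a b vs
    by (simp add: list_id_def)
  moreover have "list_id (map \<alpha> xs) = \<alpha> (list_id xs)" for xs
    using linear_map_0[OF linear_alpha] by (cases xs) (auto simp: list_id_def)
  ultimately show ?thesis
    by (simp add: list_cochains_def multilinear_def skew_def list_id_def)
qed

lemma list_ins_id:
  shows "list_ins P list_id xs = P xs"
proof -
  have "list_ins P list_id xs = unshuffle xs (\<lambda>ys zs. if zs = [] then P ys else 0)"
    unfolding list_ins_def by (rule unshuffle_cong) (simp add: list_id_def)
  thus ?thesis by (simp add: unshuffle_Nil_right)
qed

lemma cup_id_id:
  "from_list 2 (list_cup list_id list_id) = cochain_scale 2 \<mu>"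
proof
  fix x :: "nat \<Rightarrow> 'v"
  have "[x 1, x 0]\<^sub>\<g> = - [x 0, x 1]\<^sub>\<g>" by (rule bracket_skew)
  moreover have "(2::'k) *s [x 0, x 1]\<^sub>\<g> = [x 0, x 1]\<^sub>\<g> + [x 0, x 1]\<^sub>\<g>"
    using scale_left_distrib[of 1 1 "[x 0, x 1]\<^sub>\<g>"] by simp
  moreover have "map x [0..<2] = [x 0, x 1]" by (simp add: numeral_2_eq_2)
  ultimately show "from_list 2 (list_cup list_id list_id) x = cochain_scale 2 \<mu> x"
    by (simp add: from_list_def list_cup_def list_id_def cochain_scale_def \<mu>_def)
qed

lemma vector_space_cochain_scale: "vector_space cochain_scale"
  by unfold_locales (simp_all add: cochain_scale_def fun_eq_iff scale_right_distrib scale_left_distrib)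

lemma subspace_cochains: "module.subspace cochain_scale (cochains n)"
proof -
  interpret cs: vector_space cochain_scale by (rule vector_space_cochain_scale)
  note lin = linear_map_add[OF linear_alpha] linear_map_0[OF linear_alpha] linear_map_scale[OF linear_alpha]
  show ?thesis
    unfolding cs.subspace_def
  proof (intro conjI ballI allI)
    show "0 \<in> cochains n" by (simp add: cochains_def linear_0 lin)
  next
    fix f g assume f: "f \<in> cochains n" and g: "g \<in> cochains n"
    have "(f + g) x = (f + g) y" if "\<forall>i<n. x i = y i" for x y
      using cochainsD(1)[OF f, of x y] cochainsD(1)[OF g, of x y] that by simp
    moreover have "Vector_Spaces.linear scale scale (\<lambda>v. (f + g) (x(i := v)))" if "i < n" for x i
      using linear_comp_add[OF cochainsD(2)[OF f that] cochainsD(2)[OF g that]] by simp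
    moreover have "(f + g) x = 0" if "i < n" "j < n" "i \<noteq> j" "x i = x j" for x i j
      using cochainsD(3)[where x = x, OF f that] cochainsD(3)[where x = x, OF g that] by simp
    moreover have "\<alpha> ((f + g) x) = (f + g) (\<lambda>i. \<alpha> (x i))" for x
      by (simp add: lin cochainsD(4)[OF f] cochainsD(4)[OF g])
    ultimately show "f + g \<in> cochains n" unfolding cochains_def by blast
  next
    fix a f assume f: "f \<in> cochains n"
    let ?g = "cochain_scale a f"
    have "?g x = ?g y" if "\<forall>i<n. x i = y i" for x y
      using cochainsD(1)[OF f, of x y] that by (simp add: cochain_scale_def)
    moreover have "Vector_Spaces.linear scale scale (\<lambda>v. ?g (x(i := v)))" if "i < n" for x i
      using linear_comp_scale[OF cochainsD(2)[OF f that]] by (simp add: cochain_scale_def)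
    moreover have "?g x = 0" if "i < n" "j < n" "i \<noteq> j" "x i = x j" for x i j
      using cochainsD(3)[where x = x, OF f that] by (simp add: cochain_scale_def)
    moreover have "\<alpha> (?g x) = ?g (\<lambda>i. \<alpha> (x i))" for x
      by (simp add: lin cochainsD(4)[OF f] cochain_scale_def)
    ultimately show "?g \<in> cochains n" unfolding cochains_def by blast
  qed
qed

lemma cochain_insertion_lie_algebra:
  "insertion_lie_algebra cochain_scale cochains cup_bracket insertion (from_list 1 list_id) \<mu>"
proof -
  interpret cs: vector_space cochain_scale by (rule vector_space_cochain_scale)
  have add: "from_list n (\<lambda>xs. f xs + g xs) = from_list n f + from_list n g" for n f g
    by (simp add: from_list_def fun_eq_iff)
  have V1: "from_list 1 list_id \<in> cochains 1" by (intro from_list_in_cochains list_id_closed)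
  have cup: "cup_bracket m n P Q \<in> cochains (m + n)" if "P \<in> cochains m" "Q \<in> cochains n" for m n P Q
    using that by (elim cochainE) (simp add: cup_bracket_from_list from_list_in_cochains list_cup_closed)
  have cee: "cup_bracket 1 1 (from_list 1 list_id) (from_list 1 list_id) = cochain_scale 2 \<mu>"
    by (simp only: cup_bracket_from_list[OF list_id_closed list_id_closed] one_add_one cup_id_id)
  show ?thesis
  proof
    show "cs.subspace (cochains n)" for n by (rule subspace_cochains)
  next
    fix m n :: nat and P P' Q Q' a
    assume *: "m \<ge> 1" "n \<ge> 1"
    assume P: "P \<in> cochains m" and Q: "Q \<in> cochains n"
    show "cup_bracket m n P Q \<in> cochains (m + n)" by (rule cup[OF P Q])
    show "cup_bracket m n (cochain_scale a P) Q = cochain_scale a (cup_bracket m n P Q)"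
      by (simp add: cup_bracket_def cochain_scale_def fun_eq_iff linear_map_scale[OF linear_alpha_pow]
        linear_map_scale[OF linear_bracket_left] scale_sum_right mult.commute)
    show "cup_bracket m n P (cochain_scale a Q) = cochain_scale a (cup_bracket m n P Q)"
      by (simp add: cup_bracket_def cochain_scale_def fun_eq_iff linear_map_scale[OF linear_alpha_pow]
        linear_map_scale[OF linear_bracket_right] scale_sum_right mult.commute)
    show "cup_bracket m n (P + P') Q = cup_bracket m n P Q + cup_bracket m n P' Q"
      by (simp add: cup_bracket_def fun_eq_iff linear_map_add[OF linear_alpha_pow]
        linear_map_add[OF linear_bracket_left] scale_right_distrib sum.distrib)
    show "cup_bracket m n P (Q + Q') = cup_bracket m n P Q + cup_bracket m n P Q'"
      by (simp add: cup_bracket_def fun_eq_iff linear_map_add[OF linear_alpha_pow]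
        linear_map_add[OF linear_bracket_right] scale_right_distrib sum.distrib)
    obtain p where p: "p \<in> list_cochains m" "P = from_list m p" using P by (rule cochainE)
    obtain q where q: "q \<in> list_cochains n" "Q = from_list n q" using Q by (rule cochainE)
    show "cup_bracket m n P Q = - cochain_scale ((- 1) ^ (m * n)) (cup_bracket n m Q P)"
      unfolding p q cup_bracket_from_list[OF p(1) q(1)] cup_bracket_from_list[OF q(1) p(1)]
      by (simp add: fun_eq_iff from_list_def cochain_scale_def add.commute list_cup_skew[OF p(1) q(1)])
    fix k :: nat and R assume k: "k \<ge> 1" and R: "R \<in> cochains k"
    obtain r where r: "r \<in> list_cochains k" "R = from_list k r" using R by (rule cochainE)
    show "cup_bracket m (n + k) P (cup_bracket n k Q R) = cup_bracket (m + n) k (cup_bracket m n P Q) R +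
       cochain_scale ((- 1) ^ (m * n)) (cup_bracket n (m + k) Q (cup_bracket m k P R))"
      unfolding p q r using p(1) q(1) r(1)
      by (simp add: cup_bracket_from_list list_cup_closed list_cup_jacobi[OF * k])
        (simp add: fun_eq_iff from_list_def cochain_scale_def list_cup_jacobi[OF * k] add_ac)
  next
    fix m n :: nat and P P' Q Q' a
    assume *: "n \<ge> 1"
    assume P: "P \<in> cochains (Suc m)" and Q: "Q \<in> cochains n"
    obtain p where p: "p \<in> list_cochains (Suc m)" "P = from_list (Suc m) p" using P by (rule cochainE)
    obtain q where q: "q \<in> list_cochains n" "Q = from_list n q" using Q by (rule cochainE)
    show "insertion (Suc m) n P Q \<in> cochains (m + n)"
      unfolding p q insertion_from_list[OF p(1) q(1) *]
      by (intro from_list_in_cochains list_ins_closed p q *)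
    have lin: "Vector_Spaces.linear scale scale (\<lambda>v. Q (case_nat v y))" for y
    proof -
      have "(case_nat 0 y)(0 := v) = case_nat v y" for v by (auto simp: fun_eq_iff split: nat.splits)
      moreover have "Vector_Spaces.linear scale scale (\<lambda>v. Q ((case_nat 0 y)(0 := v)))"
        using Q * unfolding cochains_def by force
      ultimately show ?thesis by simp
    qed
    show "insertion (Suc m) n (cochain_scale a P) Q = cochain_scale a (insertion (Suc m) n P Q)"
      by (simp add: insertion_def cochain_scale_def fun_eq_iff linear_map_scale[OF lin] scale_sum_right mult.commute)
    show "insertion (Suc m) n P (cochain_scale a Q) = cochain_scale a (insertion (Suc m) n P Q)"
      by (simp add: insertion_def cochain_scale_def fun_eq_iff scale_sum_right mult.commute)
    show "insertion (Suc m) n (P + P') Q = insertion (Suc m) n P Q + insertion (Suc m) n P' Q"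
      by (simp add: insertion_def fun_eq_iff linear_map_add[OF lin] scale_right_distrib sum.distrib)
    show "insertion (Suc m) n P (Q + Q') = insertion (Suc m) n P Q + insertion (Suc m) n P Q'"
      by (simp add: insertion_def fun_eq_iff scale_right_distrib sum.distrib)
    fix k :: nat and R assume k: "k \<ge> 1" and R: "R \<in> cochains k"
    obtain r where r: "r \<in> list_cochains k" "R = from_list k r" using R by (rule cochainE)
    show "insertion (Suc m) (n + k) P (cup_bracket n k Q R) = cup_bracket (m + n) k (insertion (Suc m) n P Q) R +
       cochain_scale ((- 1) ^ (m * n)) (cup_bracket n (m + k) Q (insertion (Suc m) k P R))"
      unfolding p q r using p(1) q(1) r(1) * k
      by (simp add: cup_bracket_from_list insertion_from_list list_cup_closed list_ins_closed)
        (simp add: fun_eq_iff from_list_def cochain_scale_def list_ins_derivation add_ac)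
  next
    fix m n k :: nat and P Q R
    assume k: "k \<ge> 1" and P: "P \<in> cochains (Suc m)" and Q: "Q \<in> cochains (Suc n)" and R: "R \<in> cochains k"
    obtain p where p: "p \<in> list_cochains (Suc m)" "P = from_list (Suc m) p" using P by (rule cochainE)
    obtain q where q: "q \<in> list_cochains (Suc n)" "Q = from_list (Suc n) q" using Q by (rule cochainE)
    obtain r where r: "r \<in> list_cochains k" "R = from_list k r" using R by (rule cochainE)
    have *: "list_ins p q \<in> list_cochains (Suc (m + n))" "list_ins q p \<in> list_cochains (Suc (n + m))"
      using list_ins_closed[OF p(1) q(1)] list_ins_closed[OF q(1) p(1)] by simp_all
    show "insertion (Suc m) (n + k) P (insertion (Suc n) k Q R) - insertion (Suc (m + n)) k (insertion (Suc m) (Suc n) P Q) R =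
      cochain_scale ((- 1) ^ (m * n)) (insertion (Suc n) (m + k) Q (insertion (Suc m) k P R) -
        insertion (Suc (n + m)) k (insertion (Suc n) (Suc m) Q P) R)"
      unfolding p q r using p(1) q(1) r(1) k *
      using list_ins_pre_lie[OF p(1) q(1) r(1)]
      by (simp add: insertion_from_list list_ins_closed)
        (simp add: fun_eq_iff from_list_def cochain_scale_def ac_simps)
  next
    show "from_list 1 list_id \<in> cochains 1" by (rule V1)
  next
    fix m P assume "P \<in> cochains (Suc m)"
    then obtain p where p: "p \<in> list_cochains (Suc m)" "P = from_list (Suc m) p" by (rule cochainE)
    show "insertion (Suc m) 1 P (from_list 1 list_id) = P"
      unfolding p(2) insertion_from_list[OF p(1) list_id_closed order.refl]
      by (simp add: list_ins_id from_list_def fun_eq_iff)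
  next
    have "\<mu> = cochain_scale (1/2) (cochain_scale 2 \<mu>)" by (simp add: cochain_scale_def)
    also have "\<dots> = cochain_scale (1/2) (cup_bracket 1 1 (from_list 1 list_id) (from_list 1 list_id))"
      by (simp only: cee)
    also have "\<dots> \<in> cochains 2"
      using cup[OF V1 V1] by (intro cs.subspace_scale subspace_cochains) (simp add: numeral_2_eq_2)
    finally show "\<mu> \<in> cochains 2" .
  next
    show "cup_bracket 1 1 (from_list 1 list_id) (from_list 1 list_id) = cochain_scale 2 \<mu>"
      by (rule cee)
  qed
qed

theorem derived_bracket_dg_lie_algebra:
  "dg_lie_algebra cochain_scale cochains derived_bracket (d_lam lam)"
proof -
  interpret I: insertion_lie_algebra cochain_scale cochains cup_bracket insertion "from_list 1 list_id" \<mu>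
    by (rule cochain_insertion_lie_algebra)
  have "I.theta = \<theta>" by (simp add: fun_eq_iff I.theta_def \<theta>_def)
  have "I.derived m n P Q = derived_bracket m n P Q" for m n P Q
    unfolding I.derived_def derived_bracket_def \<open>I.theta = \<theta>\<close> ..
  hence "I.derived = derived_bracket" by (intro ext) simp
  moreover have "(\<lambda>n. cochain_scale (- lam) \<circ> insertion 2 n \<mu>) = d_lam lam"
    by (simp add: fun_eq_iff d_lam_def)
  ultimately show ?thesis using I.derived_dg_lie_algebra[of lam] by (simp add: o_def)
qed

end

theorem proposition5p4:
  fixes scale :: "'k::field_char_0 \<Rightarrow> 'v::ab_group_add \<Rightarrow> 'v"
    and bracket :: "'v \<Rightarrow> 'v \<Rightarrow> 'v"
    and \<alpha> :: "'v \<Rightarrow> 'v"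
    and lam :: 'k
  assumes "hom_lie_algebra scale bracket \<alpha>"
  shows "graded_derivation
           (hom_lie_algebra.cochain_scale scale)
           (hom_lie_algebra.cochains scale \<alpha>)
           (hom_lie_algebra.derived_bracket scale bracket \<alpha>)
           (hom_lie_algebra.d_lam scale bracket \<alpha> lam)
       \<and> dg_lie_algebra
           (hom_lie_algebra.cochain_scale scale)
           (hom_lie_algebra.cochains scale \<alpha>)
           (hom_lie_algebra.derived_bracket scale bracket \<alpha>)
           (hom_lie_algebra.d_lam scale bracket \<alpha> lam)"
proof -
  interpret hom_lie_algebra scale bracket \<alpha> by (rule assms)
  have dg: "dg_lie_algebra cochain_scale cochains derived_bracket (d_lam lam)"
    by (rule derived_bracket_dg_lie_algebra)
  thus ?thesis using dg_lie_algebra.d_derivation by blast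
qed

end
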